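(* Let $M$ be a closed connected Riemannian manifold, let $(\gamma_{x,y})$ be a fixed bounded Borel closing family on $M$, fix a norm $\|\cdot\|$ on $H_1(M;\mathbb R)$, let $\xi:H^1(M;\mathbb R)\to Z^1(M)$ be a linear choice of smooth closed representatives, and let $C_\xi<\infty$ be a constant such that for every continuous semimartingale $X$ on $M$, almost surely, $\|H_t(X)-\mathcal J^\xi_t\|\le C_\xi$ for all $t\ge0$. Then for every continuous semimartingale path $X$ on $M$ and all $s,t\ge0$, $$\bigl\|H_{s+t}(X)-H_s(X)-H_t(\theta_sX)\bigr\|\le 3C_\xi .$$ The bound is independent of $s$ and $t$.
   Context: A continuous semimartingale on $M$ is a continuous adapted $M$-valued process that in local coordinates is the sum of a continuous local martingale and a continuous finite-variation process. For a smooth $1$-form $\omega$, $\int_0^t\omega\circ dX_s$ is the Stratonovich integral of $\omega$ along $X$ (continuous version). A bounded Borel closing family is a family of piecewise smooth paths $\gamma_{x,y}:[0,1]\to M$, $x,y\in M$, with $\gamma_{x,y}$ going from $x$ to $y$, such that $(x,y)\mapsto\gamma_{x,y}\in C([0,1],M)$ is Borel (uniform topology on the target) and $\sup_{x,y}\operatorname{length}(\gamma_{x,y})\le L<\infty$. For a continuous path $X:[0,\infty)\to M$ and $t>0$, $\Gamma(X,t)$ is the closed path obtained by following $X_s$, $0\le s\le t$, and then $\gamma_{X_t,X_0}$ back to $X_0$. Put $H_t(X)=[\Gamma(X,t)]\in H_1(M;\mathbb R)$ (singular homology class), and $H_0=0$. The time shift is $(\theta_sX)(t)=X_{s+t}$.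 $Z^1(M)$ is the space of smooth closed $1$-forms; a linear choice of smooth closed representatives is a linear map $\xi:H^1(M;\mathbb R)\to Z^1(M)$ with $[\xi_\alpha]=\alpha$ for all $\alpha$. $\mathcal J^\xi_t\in H_1(M;\mathbb R)\simeq H^1(M;\mathbb R)^*$ is defined by $\langle\alpha,\mathcal J^\xi_t\rangle=\int_0^t\xi_\alpha\circ dX_s$, with $\langle\cdot,\cdot\rangle$ the canonical pairing of $H^1(M;\mathbb R)$ with $H_1(M;\mathbb R)$. Existence of such a $C_\xi$ is a theorem of the paper. *)

theory Defs
  imports "HOL-Probability.Probability" "HOL-Homology.Homology"
begin

section \<open>Singular homology and cohomology in degree one with real coefficients\<close>

instantiation poly_mapping :: (type, real_vector) real_vector
begin

lift_definition scaleR_poly_mapping :: "real \<Rightarrow> ('a \<Rightarrow>\<^sub>0 'b) \<Rightarrow> ('a \<Rightarrow>\<^sub>0 'b)"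
  is "\<lambda>r c x. r *\<^sub>R c x"
  by (rule finite_subset[rotated]) auto

instance
  by standard (transfer; simp add: fun_eq_iff algebra_simps)+

end

type_synonym 'a ssimplex = "(nat \<Rightarrow> real) \<Rightarrow> 'a"
type_synonym 'a rchain = "'a ssimplex \<Rightarrow>\<^sub>0 real"

definition real_chain :: "nat \<Rightarrow> 'a::topological_space rchain \<Rightarrow> bool"
  where "real_chain p c \<longleftrightarrow> (\<forall>\<sigma>\<in>Poly_Mapping.keys c. singular_simplex p euclidean \<sigma>)"

definition real_boundary :: "nat \<Rightarrow> 'a rchain \<Rightarrow> 'a rchain"
  where "real_boundary p c =
    (\<Sum>\<sigma>\<in>Poly_Mapping.keys c. Poly_Mapping.lookup c \<sigma> *\<^sub>R
       (\<Sum>k\<le>p. Poly_Mapping.single (singular_face p k \<sigma>) ((-1) ^ k)))"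

definition cochain_eval :: "('a ssimplex \<Rightarrow> real) \<Rightarrow> 'a rchain \<Rightarrow> real"
  where "cochain_eval \<phi> c = (\<Sum>\<sigma>\<in>Poly_Mapping.keys c. Poly_Mapping.lookup c \<sigma> * \<phi> \<sigma>)"

definition coboundary :: "nat \<Rightarrow> ('a ssimplex \<Rightarrow> real) \<Rightarrow> 'a ssimplex \<Rightarrow> real"
  where "coboundary p \<phi> \<sigma> = (\<Sum>k\<le>Suc p. (-1) ^ k * \<phi> (singular_face (Suc p) k \<sigma>))"

definition cycle1 :: "'a::topological_space rchain \<Rightarrow> bool"
  where "cycle1 c \<longleftrightarrow> real_chain 1 c \<and> real_boundary 1 c = 0"

definition homologous1 :: "'a::topological_space rchain \<Rightarrow> 'a rchain \<Rightarrow> bool"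
  where "homologous1 c c' \<longleftrightarrow> cycle1 c \<and> cycle1 c' \<and> (\<exists>d. real_chain 2 d \<and> c - c' = real_boundary 2 d)"

definition cocycle1 :: "('a::topological_space ssimplex \<Rightarrow> real) \<Rightarrow> bool"
  where "cocycle1 \<phi> \<longleftrightarrow> (\<forall>\<sigma>. singular_simplex 2 euclidean \<sigma> \<longrightarrow> coboundary 1 \<phi> \<sigma> = 0)"

text \<open>A real \<open>p\<close>-cochain is represented by a function on all maps of type \<open>ssimplex\<close>; only its values
  on singular \<open>p\<close>-simplices matter, and the relation below identifies cochains agreeing on these.\<close>

definition cohomologous1 :: "('a::topological_space ssimplex \<Rightarrow> real) \<Rightarrow> ('a ssimplex \<Rightarrow> real) \<Rightarrow> bool"
  where "cohomologous1 \<phi> \<phi>' \<longleftrightarrow> cocycle1 \<phi> \<and> cocycle1 \<phi>' \<and>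
    (\<exists>\<psi>. \<forall>\<sigma>. singular_simplex 1 euclidean \<sigma> \<longrightarrow> \<phi> \<sigma> - \<phi>' \<sigma> = coboundary 0 \<psi> \<sigma>)"

lemma chain_sum_superset:
  fixes f :: "'k \<Rightarrow> 'v::real_vector"
  assumes "finite S" "Poly_Mapping.keys c \<subseteq> S"
  shows "(\<Sum>x\<in>Poly_Mapping.keys c. Poly_Mapping.lookup c x *\<^sub>R f x)
       = (\<Sum>x\<in>S. Poly_Mapping.lookup c x *\<^sub>R f x)"
  using assms by (intro sum.mono_neutral_left) (auto simp: in_keys_iff)

lemma chain_sum_add:
  fixes f :: "'k \<Rightarrow> 'v::real_vector" and c d :: "'k \<Rightarrow>\<^sub>0 real"
  shows "(\<Sum>x\<in>Poly_Mapping.keys (c + d). Poly_Mapping.lookup (c + d) x *\<^sub>R f x)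
       = (\<Sum>x\<in>Poly_Mapping.keys c. Poly_Mapping.lookup c x *\<^sub>R f x)
       + (\<Sum>x\<in>Poly_Mapping.keys d. Poly_Mapping.lookup d x *\<^sub>R f x)"
proof -
  let ?S = "Poly_Mapping.keys c \<union> Poly_Mapping.keys d"
  have 1: "Poly_Mapping.keys (c + d) \<subseteq> ?S" by (rule Poly_Mapping.keys_add)
  show ?thesis
    unfolding chain_sum_superset[where S = ?S, OF _ 1, simplified]
      chain_sum_superset[where S = ?S and c = c, simplified] chain_sum_superset[where S = ?S and c = d, simplified]
    by (simp add: lookup_add scaleR_add_left sum.distrib)
qed

lemma keys_scaleR: "Poly_Mapping.keys (r *\<^sub>R c) \<subseteq> Poly_Mapping.keys c"
  by transfer auto

lemma lookup_scaleR: "Poly_Mapping.lookup (r *\<^sub>R c) x = r *\<^sub>R Poly_Mapping.lookup c x"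
  by transfer simp

lemma chain_sum_scaleR:
  fixes f :: "'k \<Rightarrow> 'v::real_vector" and c :: "'k \<Rightarrow>\<^sub>0 real"
  shows "(\<Sum>x\<in>Poly_Mapping.keys (r *\<^sub>R c). Poly_Mapping.lookup (r *\<^sub>R c) x *\<^sub>R f x)
       = r *\<^sub>R (\<Sum>x\<in>Poly_Mapping.keys c. Poly_Mapping.lookup c x *\<^sub>R f x)"
  by (subst chain_sum_superset[OF _ keys_scaleR])
     (simp_all add: lookup_scaleR scaleR_sum_right)

lemma linear_real_boundary: "linear (real_boundary p)"
  by (rule linearI) (simp_all only: real_boundary_def chain_sum_add chain_sum_scaleR)

lemma linear_cochain_eval: "linear (cochain_eval \<phi>)"
  using chain_sum_add[where f = \<phi>] chain_sum_scaleR[where f = \<phi>]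
  by (intro linearI) (simp_all add: cochain_eval_def)

lemma real_chain_0: "real_chain p 0"
  by (simp add: real_chain_def)

lemma real_chain_add: "real_chain p c \<Longrightarrow> real_chain p d \<Longrightarrow> real_chain p (c + d)"
  using Poly_Mapping.keys_add[of c d] by (auto simp: real_chain_def)

lemma real_chain_scaleR: "real_chain p c \<Longrightarrow> real_chain p (r *\<^sub>R c)"
  using keys_scaleR[of r c] by (auto simp: real_chain_def)

lemma real_chain_diff: "real_chain p c \<Longrightarrow> real_chain p d \<Longrightarrow> real_chain p (c - d)"
  using real_chain_add[OF _ real_chain_scaleR[where r = "-1"], of p c d] by simp

lemma cycle1_0: "cycle1 0"
  by (simp add: cycle1_def real_chain_0 linear_0[OF linear_real_boundary])

lemma cycle1_add: "cycle1 c \<Longrightarrow> cycle1 d \<Longrightarrow> cycle1 (c + d)"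
  by (simp add: cycle1_def real_chain_add linear_add[OF linear_real_boundary])

lemma cycle1_scaleR: "cycle1 c \<Longrightarrow> cycle1 (r *\<^sub>R c)"
  by (simp add: cycle1_def real_chain_scaleR linear_scale[OF linear_real_boundary])

lemma homologous1_refl: "cycle1 c \<Longrightarrow> homologous1 c c"
  unfolding homologous1_def
  by (auto intro!: exI[of _ 0] simp: real_chain_0 linear_0[OF linear_real_boundary])

lemma homologous1_add:
  assumes "homologous1 c c'" "homologous1 d d'"
  shows "homologous1 (c + d) (c' + d')"
proof -
  from assms obtain a b where "real_chain 2 a" "c - c' = real_boundary 2 a"
      "real_chain 2 b" "d - d' = real_boundary 2 b"
    unfolding homologous1_def by blast
  then have "real_chain 2 (a + b)" "(c + d) - (c' + d') = real_boundary 2 (a + b)"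
    by (simp_all add: real_chain_add linear_add[OF linear_real_boundary] algebra_simps)
  then show ?thesis using assms unfolding homologous1_def by (blast intro: cycle1_add)
qed

lemma homologous1_scaleR:
  assumes "homologous1 c c'"
  shows "homologous1 (r *\<^sub>R c) (r *\<^sub>R c')"
proof -
  from assms obtain a where "real_chain 2 a" "c - c' = real_boundary 2 a"
    unfolding homologous1_def by blast
  then have "real_chain 2 (r *\<^sub>R a)" "r *\<^sub>R c - r *\<^sub>R c' = real_boundary 2 (r *\<^sub>R a)"
    by (simp_all add: real_chain_scaleR linear_scale[OF linear_real_boundary]
        flip: scaleR_diff_right)
  then show ?thesis using assms unfolding homologous1_def by (blast intro: cycle1_scaleR)
qed

lemma homologous1_part_equivp: "part_equivp (homologous1 :: 'a::topological_space rchain \<Rightarrow> _)"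
proof (rule part_equivpI)
  show "\<exists>x. homologous1 x x" using homologous1_refl cycle1_0 by blast
  show "symp (homologous1 :: 'a rchain \<Rightarrow> _)"
  proof (rule sympI)
    fix c d :: "'a rchain" assume h: "homologous1 c d"
    then show "homologous1 d c"
      using homologous1_scaleR[OF h, of "-1"] unfolding homologous1_def by simp
  qed
  show "transp (homologous1 :: 'a rchain \<Rightarrow> _)"
  proof (rule transpI)
    fix c d e :: "'a rchain" assume h: "homologous1 c d" "homologous1 d e"
    then show "homologous1 c e"
      using homologous1_add[OF h] unfolding homologous1_def by (simp add: add.commute[of d])
  qed
qed

text \<open>\<open>'a hom1\<close> is \<open>H\<^sub>1('a; \<real>)\<close>: singular cycles modulo boundaries.\<close>

quotient_type (overloaded) 'a hom1 = "'a::topological_space rchain" / partial: homologous1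
  by (rule homologous1_part_equivp)

lemma cochain_sum_identities:
  shows coboundary_add: "coboundary p (\<lambda>\<sigma>. \<phi> \<sigma> + \<psi> \<sigma>) \<tau> = coboundary p \<phi> \<tau> + coboundary p \<psi> \<tau>"
    and coboundary_scale: "coboundary p (\<lambda>\<sigma>. r * \<phi> \<sigma>) \<tau> = r * coboundary p \<phi> \<tau>"
    and coboundary_0: "coboundary p (\<lambda>\<sigma>. 0) \<tau> = 0"
  by (simp_all add: coboundary_def algebra_simps sum.distrib sum_distrib_left)

lemma cocycle1_0: "cocycle1 (\<lambda>_. 0)"
  by (simp add: cocycle1_def coboundary_0)

lemma cocycle1_add: "cocycle1 \<phi> \<Longrightarrow> cocycle1 \<psi> \<Longrightarrow> cocycle1 (\<lambda>\<sigma>. \<phi> \<sigma> + \<psi> \<sigma>)"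
  by (simp add: cocycle1_def coboundary_add)

lemma cocycle1_scale: "cocycle1 \<phi> \<Longrightarrow> cocycle1 (\<lambda>\<sigma>. r * \<phi> \<sigma>)"
  by (simp add: cocycle1_def coboundary_scale)

lemma cohomologous1_refl: "cocycle1 \<phi> \<Longrightarrow> cohomologous1 \<phi> \<phi>"
  unfolding cohomologous1_def by (auto intro!: exI[of _ "\<lambda>_. 0"] simp: coboundary_0)

lemma cohomologous1_add:
  assumes "cohomologous1 \<phi> \<phi>'" "cohomologous1 \<psi> \<psi>'"
  shows "cohomologous1 (\<lambda>\<sigma>. \<phi> \<sigma> + \<psi> \<sigma>) (\<lambda>\<sigma>. \<phi>' \<sigma> + \<psi>' \<sigma>)"
proof -
  from assms obtain a b where
    "\<forall>\<sigma>. singular_simplex 1 euclidean \<sigma> \<longrightarrow> \<phi> \<sigma> - \<phi>' \<sigma> = coboundary 0 a \<sigma>"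
    "\<forall>\<sigma>. singular_simplex 1 euclidean \<sigma> \<longrightarrow> \<psi> \<sigma> - \<psi>' \<sigma> = coboundary 0 b \<sigma>"
    unfolding cohomologous1_def by blast
  then have "\<forall>\<sigma>. singular_simplex 1 euclidean \<sigma> \<longrightarrow>
      (\<phi> \<sigma> + \<psi> \<sigma>) - (\<phi>' \<sigma> + \<psi>' \<sigma>) = coboundary 0 (\<lambda>\<sigma>. a \<sigma> + b \<sigma>) \<sigma>"
    by (auto simp only: coboundary_add add_diff_add)
  then show ?thesis using assms unfolding cohomologous1_def by (blast intro: cocycle1_add)
qed

lemma cohomologous1_scale:
  assumes "cohomologous1 \<phi> \<phi>'"
  shows "cohomologous1 (\<lambda>\<sigma>. r * \<phi> \<sigma>) (\<lambda>\<sigma>. r * \<phi>' \<sigma>)"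
proof -
  from assms obtain a where
    "\<forall>\<sigma>. singular_simplex 1 euclidean \<sigma> \<longrightarrow> \<phi> \<sigma> - \<phi>' \<sigma> = coboundary 0 a \<sigma>"
    unfolding cohomologous1_def by blast
  then have "\<forall>\<sigma>. singular_simplex 1 euclidean \<sigma> \<longrightarrow>
      r * \<phi> \<sigma> - r * \<phi>' \<sigma> = coboundary 0 (\<lambda>\<sigma>. r * a \<sigma>) \<sigma>"
    by (simp add: coboundary_scale flip: right_diff_distrib)
  then show ?thesis using assms unfolding cohomologous1_def by (blast intro: cocycle1_scale)
qed

lemma cohomologous1_part_equivp: "part_equivp (cohomologous1 :: ('a::topological_space ssimplex \<Rightarrow> real) \<Rightarrow> _)"
proof (rule part_equivpI)
  show "\<exists>x. cohomologous1 x x" using cohomologous1_refl cocycle1_0 by blast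
  show "symp (cohomologous1 :: ('a ssimplex \<Rightarrow> real) \<Rightarrow> _)"
  proof (rule sympI)
    fix \<phi> \<psi> :: "'a ssimplex \<Rightarrow> real" assume h: "cohomologous1 \<phi> \<psi>"
    then show "cohomologous1 \<psi> \<phi>"
      using cohomologous1_scale[OF h, of "-1"] unfolding cohomologous1_def by simp
  qed
  show "transp (cohomologous1 :: ('a ssimplex \<Rightarrow> real) \<Rightarrow> _)"
  proof (rule transpI)
    fix \<phi> \<psi> \<eta> :: "'a ssimplex \<Rightarrow> real" assume h: "cohomologous1 \<phi> \<psi>" "cohomologous1 \<psi> \<eta>"
    then show "cohomologous1 \<phi> \<eta>"
      using cohomologous1_add[OF h] unfolding cohomologous1_def by (simp add: add.commute[of "\<psi> _"])
  qed
qed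

text \<open>\<open>'a cohom1\<close> is \<open>H\<^sup>1('a; \<real>)\<close>: singular cocycles modulo coboundaries.\<close>

quotient_type (overloaded) 'a cohom1 = "'a::topological_space ssimplex \<Rightarrow> real" / partial: cohomologous1
  by (rule cohomologous1_part_equivp)

instantiation hom1 :: (topological_space) real_vector
begin

lift_definition zero_hom1 :: "'a hom1" is 0
  by (rule homologous1_refl[OF cycle1_0])
lift_definition plus_hom1 :: "'a hom1 \<Rightarrow> 'a hom1 \<Rightarrow> 'a hom1" is "(+)"
  by (rule homologous1_add)
lift_definition scaleR_hom1 :: "real \<Rightarrow> 'a hom1 \<Rightarrow> 'a hom1" is "(*\<^sub>R)"
  by (rule homologous1_scaleR)
lift_definition uminus_hom1 :: "'a hom1 \<Rightarrow> 'a hom1" is uminus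
  using homologous1_scaleR[where r = "-1"] by simp
lift_definition minus_hom1 :: "'a hom1 \<Rightarrow> 'a hom1 \<Rightarrow> 'a hom1" is "(-)"
  using homologous1_add[OF _ homologous1_scaleR[where r = "-1"]] by simp

instance
proof
  fix x y z :: "'a hom1" and a b :: real
  show "x + y + z = x + (y + z)"
    by transfer (auto simp: add.assoc intro!: homologous1_refl cycle1_add dest: homologous1_def[THEN iffD1])
  show "x + y = y + x"
    by transfer (auto simp: add.commute intro!: homologous1_refl cycle1_add dest: homologous1_def[THEN iffD1])
  show "0 + x = x" by transfer simp
  show "- x + x = 0" by transfer (simp add: homologous1_refl cycle1_0)
  show "x - y = x + - y"
    by transfer (metis add_uminus_conv_diff cycle1_add cycle1_scaleR homologous1_def homologous1_refl scaleR_minus1_left)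
  show "a *\<^sub>R (x + y) = a *\<^sub>R x + a *\<^sub>R y"
    by transfer (metis scaleR_add_right cycle1_add cycle1_scaleR homologous1_def homologous1_refl)
  show "(a + b) *\<^sub>R x = a *\<^sub>R x + b *\<^sub>R x"
    by transfer (metis scaleR_add_left cycle1_add cycle1_scaleR homologous1_def homologous1_refl)
  show "a *\<^sub>R b *\<^sub>R x = (a * b) *\<^sub>R x"
    by transfer (metis scaleR_scaleR cycle1_scaleR homologous1_def homologous1_refl)
  show "1 *\<^sub>R x = x" by transfer simp
qed

end

instantiation cohom1 :: (topological_space) real_vector
begin

lift_definition zero_cohom1 :: "'a cohom1" is "\<lambda>_. 0"
  by (rule cohomologous1_refl[OF cocycle1_0])
lift_definition plus_cohom1 :: "'a cohom1 \<Rightarrow> 'a cohom1 \<Rightarrow> 'a cohom1" is "\<lambda>\<phi> \<psi> \<sigma>. \<phi> \<sigma> + \<psi> \<sigma>"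
  by (rule cohomologous1_add)
lift_definition scaleR_cohom1 :: "real \<Rightarrow> 'a cohom1 \<Rightarrow> 'a cohom1" is "\<lambda>r \<phi> \<sigma>. r * \<phi> \<sigma>"
  by (rule cohomologous1_scale)
lift_definition uminus_cohom1 :: "'a cohom1 \<Rightarrow> 'a cohom1" is "\<lambda>\<phi> \<sigma>. - \<phi> \<sigma>"
  using cohomologous1_scale[where r = "-1"] by simp
lift_definition minus_cohom1 :: "'a cohom1 \<Rightarrow> 'a cohom1 \<Rightarrow> 'a cohom1" is "\<lambda>\<phi> \<psi> \<sigma>. \<phi> \<sigma> - \<psi> \<sigma>"
  using cohomologous1_add[OF _ cohomologous1_scale[where r = "-1"]] by simp

lemma cohomologous1_reflD: "cohomologous1 \<phi> \<phi> \<longleftrightarrow> cocycle1 \<phi>"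
  using cohomologous1_refl cohomologous1_def by blast

instance
proof
  fix x y z :: "'a cohom1" and a b :: real
  note r = cohomologous1_reflD cocycle1_add cocycle1_scale
  have diff: "cocycle1 (\<lambda>\<sigma>. \<phi> \<sigma> - \<psi> \<sigma>)" if "cocycle1 \<phi>" "cocycle1 \<psi>"
    for \<phi> \<psi> :: "'a ssimplex \<Rightarrow> real"
    using cocycle1_add[OF that(1) cocycle1_scale[OF that(2), of "-1"]] by simp
  show "x + y + z = x + (y + z)"
    by transfer (simp add: add.assoc r cocycle1_add[OF _ cocycle1_add])
  show "x + y = y + x"
    by transfer (simp add: add.commute r)
  show "0 + x = x" by transfer simp
  show "- x + x = 0" by transfer (simp add: r cocycle1_0)
  show "x - y = x + - y"
    by transfer (simp add: r diff)
  show "a *\<^sub>R (x + y) = a *\<^sub>R x + a *\<^sub>R y"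
    by transfer (simp add: r distrib_left cocycle1_add[OF cocycle1_scale cocycle1_scale])
  show "(a + b) *\<^sub>R x = a *\<^sub>R x + b *\<^sub>R x"
    by transfer (simp add: r distrib_right cocycle1_add[OF cocycle1_scale cocycle1_scale])
  show "a *\<^sub>R b *\<^sub>R x = (a * b) *\<^sub>R x"
    by transfer (simp add: r mult.assoc cocycle1_scale[OF cocycle1_scale, simplified])
  show "1 *\<^sub>R x = x" by transfer simp
qed

end

lemma cochain_eval_single: "cochain_eval \<phi> (Poly_Mapping.single \<sigma> a) = a * \<phi> \<sigma>"
  by (simp add: cochain_eval_def)

lemma cochain_eval_boundary:
  "cochain_eval \<phi> (real_boundary (Suc p) d) = cochain_eval (coboundary p \<phi>) d"
proof -
  have "cochain_eval \<phi> (real_boundary (Suc p) d) =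
      (\<Sum>\<sigma>\<in>Poly_Mapping.keys d. Poly_Mapping.lookup d \<sigma> *
        (\<Sum>k\<le>Suc p. cochain_eval \<phi> (Poly_Mapping.single (singular_face (Suc p) k \<sigma>) ((-1) ^ k))))"
    unfolding real_boundary_def
    by (simp only: linear_sum[OF linear_cochain_eval] linear_scale[OF linear_cochain_eval] real_scaleR_def)
  then show ?thesis
    by (simp only: cochain_eval_single) (simp only: cochain_eval_def coboundary_def)
qed

text \<open>The canonical pairing of cohomology with homology, by evaluating a cocycle on a cycle.\<close>

lift_definition cpair :: "'a::topological_space cohom1 \<Rightarrow> 'a hom1 \<Rightarrow> real" is cochain_eval
proof -
  fix \<phi> \<phi>' :: "'a ssimplex \<Rightarrow> real" and c c' :: "'a rchain"
  assume a: "cohomologous1 \<phi> \<phi>'" and h: "homologous1 c c'"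
  obtain \<psi> where \<psi>: "\<And>\<sigma>. singular_simplex 1 euclidean \<sigma> \<Longrightarrow> \<phi> \<sigma> - \<phi>' \<sigma> = coboundary 0 \<psi> \<sigma>"
    using a unfolding cohomologous1_def by blast
  obtain d where d: "real_chain 2 d" "c - c' = real_boundary 2 d"
    using h unfolding homologous1_def by blast
  have c: "real_chain 1 c'" "real_boundary 1 c' = 0"
    using h unfolding homologous1_def cycle1_def by auto
  have "cochain_eval \<phi> c - cochain_eval \<phi> c' = cochain_eval (coboundary 1 \<phi>) d"
    using cochain_eval_boundary[of \<phi> 1 d] linear_diff[OF linear_cochain_eval, of \<phi> c c'] d(2)
    by (simp add: numeral_2_eq_2)
  also have "\<dots> = 0"
    using d(1) a by (auto simp: cochain_eval_def real_chain_def cohomologous1_def cocycle1_def)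
  finally have 1: "cochain_eval \<phi> c = cochain_eval \<phi> c'" by simp
  have "cochain_eval \<phi> c' - cochain_eval \<phi>' c' = cochain_eval (coboundary 0 \<psi>) c'"
    using c(1) unfolding cochain_eval_def real_chain_def sum_subtractf[symmetric]
    by (intro sum.cong) (auto simp: \<psi> simp flip: right_diff_distrib)
  also have "\<dots> = 0"
    using cochain_eval_boundary[of \<psi> 0 c'] c(2) linear_0[OF linear_cochain_eval, of \<psi>] by simp
  finally show "cochain_eval \<phi> c = cochain_eval \<phi>' c'" using 1 by simp
qed

definition path_simplex :: "(real \<Rightarrow> 'a) \<Rightarrow> 'a ssimplex"
  where "path_simplex c = restrict (\<lambda>x. c (x 1)) (standard_simplex 1)"

definition simplex_path :: "'a ssimplex \<Rightarrow> real \<Rightarrow> 'a"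
  where "simplex_path \<sigma> u = \<sigma> (\<lambda>i. if i = 0 then 1 - u else if i = 1 then u else 0)"

definition loop_class :: "(real \<Rightarrow> 'a::topological_space) \<Rightarrow> 'a hom1"
  where "loop_class c = abs_hom1 (Poly_Mapping.single (path_simplex c) 1)"

definition norm_on_space :: "('v::real_vector \<Rightarrow> real) \<Rightarrow> bool"
  where "norm_on_space N \<longleftrightarrow> (\<forall>x. 0 \<le> N x) \<and> (\<forall>x. N x = 0 \<longleftrightarrow> x = 0) \<and>
    (\<forall>r x. N (r *\<^sub>R x) = \<bar>r\<bar> * N x) \<and> (\<forall>x y. N (x + y) \<le> N x + N y)"


section \<open>Smooth manifolds\<close>

text \<open>\<open>smooth_on\<close> is only meaningful on open sets; it requires all iterated directional derivatives to
  exist and be continuous.\<close>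

primrec Ck_on :: "nat \<Rightarrow> 'a::real_normed_vector set \<Rightarrow> ('a \<Rightarrow> 'b::real_normed_vector) \<Rightarrow> bool" where
  "Ck_on 0 S f \<longleftrightarrow> continuous_on S f"
| "Ck_on (Suc k) S f \<longleftrightarrow> (\<forall>x\<in>S. f differentiable (at x)) \<and>
     (\<forall>v. Ck_on k S (\<lambda>x. frechet_derivative f (at x) v))"

definition smooth_on :: "'a::real_normed_vector set \<Rightarrow> ('a \<Rightarrow> 'b::real_normed_vector) \<Rightarrow> bool"
  where "smooth_on S f \<longleftrightarrow> (\<forall>k. Ck_on k S f)"

text \<open>A chart is a pair of its domain and its coordinate map. The manifold itself is the whole type \<open>'m\<close>
  (Hausdorff and second countable by its sort), of dimension \<open>DIM('e)\<close>.\<close>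

type_synonym ('m, 'e) chart = "'m set \<times> ('m \<Rightarrow> 'e)"

definition smooth_atlas ::
    "('m::{second_countable_topology,t2_space}, 'e::euclidean_space) chart set \<Rightarrow> bool"
  where "smooth_atlas A \<longleftrightarrow>
    (\<forall>(U, \<phi>)\<in>A. open U \<and> open (\<phi> ` U) \<and> homeomorphism U (\<phi> ` U) \<phi> (inv_into U \<phi>)) \<and>
    (\<Union>(U, \<phi>)\<in>A. U) = UNIV \<and>
    (\<forall>(U, \<phi>)\<in>A. \<forall>(V, \<psi>)\<in>A. smooth_on (\<phi> ` (U \<inter> V)) (\<psi> \<circ> inv_into U \<phi>))"

definition smooth_fun :: "('m, 'e::euclidean_space) chart set \<Rightarrow> ('m \<Rightarrow> real) \<Rightarrow> bool"
  where "smooth_fun A f \<longleftrightarrow> (\<forall>(U, \<phi>)\<in>A. smooth_on (\<phi> ` U) (f \<circ> inv_into U \<phi>))"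

text \<open>Tangent vectors at \<open>p\<close> are the derivations at \<open>p\<close> of the algebra of smooth functions, extended by
  zero to non-smooth functions.\<close>

type_synonym 'm tvec = "('m \<Rightarrow> real) \<Rightarrow> real"

definition tangent_space :: "('m, 'e::euclidean_space) chart set \<Rightarrow> 'm \<Rightarrow> 'm tvec set"
  where "tangent_space A p = {D.
    (\<forall>f. \<not> smooth_fun A f \<longrightarrow> D f = 0) \<and>
    (\<forall>f g a b. smooth_fun A f \<longrightarrow> smooth_fun A g \<longrightarrow>
       D (\<lambda>x. a * f x + b * g x) = a * D f + b * D g \<and>
       D (\<lambda>x. f x * g x) = f p * D g + g p * D f)}"

text \<open>The vector at \<open>p\<close> with coordinates \<open>v\<close> in a chart, i.e. \<open>\<Sum>\<^sub>i v\<^sup>i \<partial>/\<partial>x\<^sup>i\<close>.\<close>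

definition coord_vec ::
    "('m, 'e::euclidean_space) chart set \<Rightarrow> ('m, 'e) chart \<Rightarrow> 'm \<Rightarrow> 'e \<Rightarrow> 'm tvec"
  where "coord_vec A = (\<lambda>(U, \<phi>) p v f.
    if smooth_fun A f then frechet_derivative (f \<circ> inv_into U \<phi>) (at (\<phi> p)) v else 0)"

definition velocity :: "('m, 'e::euclidean_space) chart set \<Rightarrow> (real \<Rightarrow> 'm) \<Rightarrow> real \<Rightarrow> 'm tvec"
  where "velocity A c t f = (if smooth_fun A f then vector_derivative (f \<circ> c) (at t) else 0)"

text \<open>The local expression of a 1-form: \<open>form_coeff A (U, \<phi>) \<omega> x v = \<Sum>\<^sub>i \<omega>\<^sub>i(x) v\<^sup>i\<close>.\<close>

definition form_coeff :: "('m, 'e::euclidean_space) chart set \<Rightarrow> ('m, 'e) chart \<Rightarrow>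
    ('m \<Rightarrow> 'm tvec \<Rightarrow> real) \<Rightarrow> 'e \<Rightarrow> 'e \<Rightarrow> real"
  where "form_coeff A = (\<lambda>(U, \<phi>) \<omega> x v.
    \<omega> (inv_into U \<phi> x) (coord_vec A (U, \<phi>) (inv_into U \<phi> x) v))"

definition smooth_one_form :: "('m, 'e::euclidean_space) chart set \<Rightarrow> ('m \<Rightarrow> 'm tvec \<Rightarrow> real) \<Rightarrow> bool"
  where "smooth_one_form A \<omega> \<longleftrightarrow>
    (\<forall>p. \<forall>D\<in>tangent_space A p. \<forall>E\<in>tangent_space A p. \<forall>a b.
       \<omega> p (\<lambda>f. a * D f + b * E f) = a * \<omega> p D + b * \<omega> p E) \<and>
    (\<forall>(U, \<phi>)\<in>A. \<forall>v. smooth_on (\<phi> ` U) (\<lambda>x. form_coeff A (U, \<phi>) \<omega> x v))"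

text \<open>Closedness is \<open>\<partial>\<^sub>i \<omega>\<^sub>j = \<partial>\<^sub>j \<omega>\<^sub>i\<close> in all charts, contracted with arbitrary constant vectors.\<close>

definition closed_one_form :: "('m, 'e::euclidean_space) chart set \<Rightarrow> ('m \<Rightarrow> 'm tvec \<Rightarrow> real) \<Rightarrow> bool"
  where "closed_one_form A \<omega> \<longleftrightarrow> smooth_one_form A \<omega> \<and>
    (\<forall>(U, \<phi>)\<in>A. \<forall>x\<in>\<phi> ` U. \<forall>v w.
       frechet_derivative (\<lambda>y. form_coeff A (U, \<phi>) \<omega> y w) (at x) v =
       frechet_derivative (\<lambda>y. form_coeff A (U, \<phi>) \<omega> y v) (at x) w)"

definition riemannian_metric ::
    "('m, 'e::euclidean_space) chart set \<Rightarrow> ('m \<Rightarrow> 'm tvec \<Rightarrow> 'm tvec \<Rightarrow> real) \<Rightarrow> bool"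
  where "riemannian_metric A g \<longleftrightarrow>
    (\<forall>p. \<forall>D\<in>tangent_space A p. \<forall>E\<in>tangent_space A p. g p D E = g p E D) \<and>
    (\<forall>p. \<forall>D\<in>tangent_space A p. \<forall>E\<in>tangent_space A p. \<forall>G\<in>tangent_space A p. \<forall>a b.
       g p (\<lambda>f. a * D f + b * E f) G = a * g p D G + b * g p E G) \<and>
    (\<forall>p. \<forall>D\<in>tangent_space A p. D \<noteq> (\<lambda>_. 0) \<longrightarrow> g p D D > 0) \<and>
    (\<forall>(U, \<phi>)\<in>A. \<forall>v w. smooth_on (\<phi> ` U) (\<lambda>x. g (inv_into U \<phi> x)
       (coord_vec A (U, \<phi>) (inv_into U \<phi> x) v) (coord_vec A (U, \<phi>) (inv_into U \<phi> x) w)))"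

text \<open>Smoothness of a curve on a compact interval means that it extends smoothly to a neighbourhood.\<close>

definition smooth_path_on ::
    "('m::topological_space, 'e::euclidean_space) chart set \<Rightarrow> (real \<Rightarrow> 'm) \<Rightarrow> real \<Rightarrow> real \<Rightarrow> bool"
  where "smooth_path_on A c a b \<longleftrightarrow>
    (\<exists>c' W. open W \<and> {a..b} \<subseteq> W \<and> (\<forall>t\<in>{a..b}. c' t = c t) \<and> continuous_on W c' \<and>
       (\<forall>(U, \<phi>)\<in>A. smooth_on (W \<inter> c' -` U) (\<phi> \<circ> c')))"

definition piecewise_smooth_path ::
    "('m::topological_space, 'e::euclidean_space) chart set \<Rightarrow> (real \<Rightarrow> 'm) \<Rightarrow> bool"
  where "piecewise_smooth_path A c \<longleftrightarrow> path c \<and>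
    (\<exists>n r. r 0 = 0 \<and> r n = 1 \<and>
       (\<forall>k<n. r k < r (Suc k) \<and> smooth_path_on A c (r k) (r (Suc k))))"

definition line_integral ::
    "('m, 'e::euclidean_space) chart set \<Rightarrow> ('m \<Rightarrow> 'm tvec \<Rightarrow> real) \<Rightarrow> (real \<Rightarrow> 'm) \<Rightarrow> real"
  where "line_integral A \<omega> c = integral {0..1} (\<lambda>t. \<omega> (c t) (velocity A c t))"

definition path_length :: "('m, 'e::euclidean_space) chart set \<Rightarrow>
    ('m \<Rightarrow> 'm tvec \<Rightarrow> 'm tvec \<Rightarrow> real) \<Rightarrow> (real \<Rightarrow> 'm) \<Rightarrow> real"
  where "path_length A g c = integral {0..1} (\<lambda>t. sqrt (g (c t) (velocity A c t) (velocity A c t)))"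

definition riemannian_dist :: "('m::topological_space, 'e::euclidean_space) chart set \<Rightarrow>
    ('m \<Rightarrow> 'm tvec \<Rightarrow> 'm tvec \<Rightarrow> real) \<Rightarrow> 'm \<Rightarrow> 'm \<Rightarrow> real"
  where "riemannian_dist A g x y =
    Inf {path_length A g c | c. piecewise_smooth_path A c \<and> pathstart c = x \<and> pathfinish c = y}"

text \<open>The de Rham class of a closed form as a singular cohomology class: it is determined by the
  integrals of the form over smooth singular cycles.\<close>

definition de_rham_class ::
    "('m::topological_space, 'e::euclidean_space) chart set \<Rightarrow> ('m \<Rightarrow> 'm tvec \<Rightarrow> real) \<Rightarrow> 'm cohom1 \<Rightarrow> bool"
  where "de_rham_class A \<omega> \<alpha> \<longleftrightarrow>
    (\<forall>c. cycle1 c \<and> (\<forall>\<sigma>\<in>Poly_Mapping.keys c. smooth_path_on A (simplex_path \<sigma>) 0 1) \<longrightarrow>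
       cpair \<alpha> (abs_hom1 c) = cochain_eval (\<lambda>\<sigma>. line_integral A \<omega> (simplex_path \<sigma>)) c)"

definition linear_closed_representatives :: "('m::topological_space, 'e::euclidean_space) chart set \<Rightarrow>
    ('m cohom1 \<Rightarrow> 'm \<Rightarrow> 'm tvec \<Rightarrow> real) \<Rightarrow> bool"
  where "linear_closed_representatives A \<xi> \<longleftrightarrow>
    (\<forall>\<alpha>. closed_one_form A (\<xi> \<alpha>) \<and> de_rham_class A (\<xi> \<alpha>) \<alpha>) \<and>
    (\<forall>a b \<alpha> \<beta> p. \<forall>D\<in>tangent_space A p.
       \<xi> (a *\<^sub>R \<alpha> + b *\<^sub>R \<beta>) p D = a * \<xi> \<alpha> p D + b * \<xi> \<beta> p D)"


section \<open>Closing families and the homology process\<close>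

text \<open>Open sets of \<open>C([0,1], M)\<close> in the uniform topology of a distance \<open>d\<close>. Paths are functions on the
  real line, but membership in such a set only depends on their restriction to the unit interval.\<close>

definition uniform_open :: "('m \<Rightarrow> 'm \<Rightarrow> real) \<Rightarrow> (real \<Rightarrow> 'm::topological_space) set \<Rightarrow> bool"
  where "uniform_open d S \<longleftrightarrow>
    (\<forall>c\<in>S. path c \<longrightarrow> (\<exists>\<epsilon>>0. \<forall>c'. path c' \<and> (\<forall>t\<in>{0..1}. d (c t) (c' t) < \<epsilon>) \<longrightarrow> c' \<in> S))"

definition bounded_borel_closing_family ::
    "('m::{second_countable_topology,t2_space}, 'e::euclidean_space) chart set \<Rightarrow>
     ('m \<Rightarrow> 'm tvec \<Rightarrow> 'm tvec \<Rightarrow> real) \<Rightarrow> ('m \<Rightarrow> 'm \<Rightarrow> real \<Rightarrow> 'm) \<Rightarrow> bool"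
  where "bounded_borel_closing_family A g \<gamma> \<longleftrightarrow>
    (\<forall>x y. piecewise_smooth_path A (\<gamma> x y) \<and> pathstart (\<gamma> x y) = x \<and> pathfinish (\<gamma> x y) = y) \<and>
    (\<forall>S. uniform_open (riemannian_dist A g) S \<longrightarrow> {(x, y). \<gamma> x y \<in> S} \<in> sets borel) \<and>
    (\<exists>L. \<forall>x y. path_length A g (\<gamma> x y) \<le> L)"

definition homology_process ::
    "('m::topological_space \<Rightarrow> 'm \<Rightarrow> real \<Rightarrow> 'm) \<Rightarrow> real \<Rightarrow> (real \<Rightarrow> 'm) \<Rightarrow> 'm hom1"
  where "homology_process \<gamma> t X =
    (if t = 0 then 0 else loop_class ((\<lambda>u. X (t * u)) +++ \<gamma> (X t) (X 0)))"

definition time_shift :: "real \<Rightarrow> (real \<Rightarrow> 'm) \<Rightarrow> real \<Rightarrow> 'm"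
  where "time_shift s X t = X (s + t)"


section \<open>Continuous semimartingales and Stratonovich integrals\<close>

text \<open>Time runs over \<open>[0,\<infinity>)\<close>; the values of filtrations and processes at negative times are irrelevant.\<close>

definition filtered_prob_space :: "'w measure \<Rightarrow> (real \<Rightarrow> 'w measure) \<Rightarrow> bool"
  where "filtered_prob_space P F \<longleftrightarrow>
    prob_space P \<and> filtration (space P) F \<and> (\<forall>t. subalgebra P (F t))"

text \<open>Stopping times with values in \<open>[0,\<infinity>]\<close>.\<close>

definition ext_stopping_time :: "'w measure \<Rightarrow> (real \<Rightarrow> 'w measure) \<Rightarrow> ('w \<Rightarrow> ereal) \<Rightarrow> bool"
  where "ext_stopping_time P F \<tau> \<longleftrightarrow> (\<forall>\<omega>\<in>space P. 0 \<le> \<tau> \<omega>) \<and>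
    (\<forall>t\<ge>0. Measurable.pred (F t) (\<lambda>\<omega>. \<tau> \<omega> \<le> ereal t))"

definition continuous_adapted ::
    "'w measure \<Rightarrow> (real \<Rightarrow> 'w measure) \<Rightarrow> (real \<Rightarrow> 'w \<Rightarrow> 'a::topological_space) \<Rightarrow> bool"
  where "continuous_adapted P F Y \<longleftrightarrow> (\<forall>t\<ge>0. Y t \<in> measurable (F t) borel) \<and>
    (\<forall>\<omega>\<in>space P. continuous_on {0..} (\<lambda>t. Y t \<omega>))"

definition is_martingale :: "'w measure \<Rightarrow> (real \<Rightarrow> 'w measure) \<Rightarrow> (real \<Rightarrow> 'w \<Rightarrow> real) \<Rightarrow> bool"
  where "is_martingale P F Y \<longleftrightarrow>
    (\<forall>t\<ge>0. Y t \<in> borel_measurable (F t) \<and> integrable P (Y t)) \<and>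
    (\<forall>s\<ge>0. \<forall>t\<ge>s. AE \<omega> in P. real_cond_exp P (F s) (Y t) \<omega> = Y s \<omega>)"

definition continuous_local_martingale ::
    "'w measure \<Rightarrow> (real \<Rightarrow> 'w measure) \<Rightarrow> (real \<Rightarrow> 'w \<Rightarrow> real) \<Rightarrow> bool"
  where "continuous_local_martingale P F Y \<longleftrightarrow> continuous_adapted P F Y \<and>
    (\<exists>T :: nat \<Rightarrow> 'w \<Rightarrow> ereal. (\<forall>n. ext_stopping_time P F (T n)) \<and>
       (AE \<omega> in P. incseq (\<lambda>n. T n \<omega>) \<and> (\<lambda>n. T n \<omega>) \<longlonglongrightarrow> \<infinity>) \<and>
       (\<forall>n. is_martingale P F (\<lambda>t \<omega>. Y (real_of_ereal (min (ereal t) (T n \<omega>))) \<omega> - Y 0 \<omega>)))"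

definition partition_of :: "real \<Rightarrow> nat \<Rightarrow> (nat \<Rightarrow> real) \<Rightarrow> bool"
  where "partition_of t n r \<longleftrightarrow> r 0 = 0 \<and> r n = t \<and> (\<forall>k<n. r k \<le> r (Suc k))"

definition continuous_finite_variation ::
    "'w measure \<Rightarrow> (real \<Rightarrow> 'w measure) \<Rightarrow> (real \<Rightarrow> 'w \<Rightarrow> real) \<Rightarrow> bool"
  where "continuous_finite_variation P F Y \<longleftrightarrow> continuous_adapted P F Y \<and>
    (AE \<omega> in P. \<forall>t\<ge>0. \<exists>B. \<forall>n r. partition_of t n r \<longrightarrow>
       (\<Sum>k<n. \<bar>Y (r (Suc k)) \<omega> - Y (r k) \<omega>\<bar>) \<le> B)"

definition real_continuous_semimartingale ::
    "'w measure \<Rightarrow> (real \<Rightarrow> 'w measure) \<Rightarrow> (real \<Rightarrow> 'w \<Rightarrow> real) \<Rightarrow> bool"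
  where "real_continuous_semimartingale P F Y \<longleftrightarrow> continuous_adapted P F Y \<and>
    (\<exists>N V. continuous_local_martingale P F N \<and> continuous_finite_variation P F V \<and>
       (AE \<omega> in P. \<forall>t\<ge>0. Y t \<omega> = N t \<omega> + V t \<omega>))"

text \<open>A chart only sees the process while it stays in the chart domain, so ``in local coordinates'' is
  made precise on stochastic intervals \<open>[\<sigma>, \<tau>]\<close> during which the process stays in a chart domain.\<close>

definition chart_interval :: "'w measure \<Rightarrow> (real \<Rightarrow> 'w measure) \<Rightarrow> (real \<Rightarrow> 'w \<Rightarrow> 'm) \<Rightarrow> 'm set \<Rightarrow>
    ('w \<Rightarrow> ereal) \<Rightarrow> ('w \<Rightarrow> ereal) \<Rightarrow> bool"
  where "chart_interval P F X U \<sigma> \<tau> \<longleftrightarrow>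
    ext_stopping_time P F \<sigma> \<and> ext_stopping_time P F \<tau> \<and> (\<forall>\<omega>\<in>space P. \<sigma> \<omega> \<le> \<tau> \<omega>) \<and>
    (\<forall>\<omega>\<in>space P. \<forall>t\<ge>0. \<sigma> \<omega> \<le> ereal t \<and> ereal t \<le> \<tau> \<omega> \<longrightarrow> X t \<omega> \<in> U)"

text \<open>The time \<open>t\<close> projected to \<open>[\<sigma>, \<tau>]\<close>; it is only used where \<open>\<sigma>\<close> is finite.\<close>

definition clamp_time :: "ereal \<Rightarrow> ereal \<Rightarrow> real \<Rightarrow> real"
  where "clamp_time \<sigma> \<tau> t = real_of_ereal (max \<sigma> (min \<tau> (ereal t)))"

text \<open>The coordinate process is started at \<open>\<sigma>\<close> (increments from its value there, zero before) and
  stopped at \<open>\<tau>\<close>; the value at \<open>\<sigma>\<close> is subtracted since it is not known before \<open>\<sigma>\<close>.\<close>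

definition continuous_semimartingale ::
    "('m::topological_space, 'e::euclidean_space) chart set \<Rightarrow> 'w measure \<Rightarrow> (real \<Rightarrow> 'w measure) \<Rightarrow>
     (real \<Rightarrow> 'w \<Rightarrow> 'm) \<Rightarrow> bool"
  where "continuous_semimartingale A P F X \<longleftrightarrow> continuous_adapted P F X \<and>
    (\<forall>(U, \<phi>)\<in>A. \<forall>\<sigma> \<tau>. chart_interval P F X U \<sigma> \<tau> \<longrightarrow>
       (\<forall>b\<in>Basis. real_continuous_semimartingale P F (\<lambda>t \<omega>.
          if \<sigma> \<omega> \<le> ereal t
          then (\<phi> (X (clamp_time (\<sigma> \<omega>) (\<tau> \<omega>) t) \<omega>) - \<phi> (X (real_of_ereal (\<sigma> \<omega>)) \<omega>)) \<bullet> b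
          else 0)))"

text \<open>The trapezoidal sum
  \<open>\<Sum>\<^sub>k \<Sum>\<^sub>i (\<omega>\<^sub>i(x\<^sub>k) + \<omega>\<^sub>i(x\<^sub>k\<^sub>+\<^sub>1)) / 2 * (x\<^sub>k\<^sub>+\<^sub>1\<^sup>i - x\<^sub>k\<^sup>i)\<close> along the points
  \<open>x\<^sub>k = \<phi> (Y (u k))\<close>.\<close>

definition stratonovich_sum :: "('m, 'e::euclidean_space) chart set \<Rightarrow> ('m, 'e) chart \<Rightarrow>
    ('m \<Rightarrow> 'm tvec \<Rightarrow> real) \<Rightarrow> (real \<Rightarrow> 'm) \<Rightarrow> nat \<Rightarrow> (nat \<Rightarrow> real) \<Rightarrow> real"
  where "stratonovich_sum A K \<omega> Y n u =
    (\<Sum>k<n. let x = snd K (Y (u k)); y = snd K (Y (u (Suc k)))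
            in (form_coeff A K \<omega> x (y - x) + form_coeff A K \<omega> y (y - x)) / 2)"

text \<open>\<open>is_stratonovich A P F X \<theta> I\<close>: the process \<open>I\<close> is a continuous version of
  \<open>t \<mapsto> \<integral>\<^sub>0\<^sup>t \<theta> \<circ> dX\<close>. Its increments over every stochastic interval \<open>[\<sigma>, \<tau>]\<close> spent in a chart are
  \<open>\<Sum>\<^sub>i \<integral> \<theta>\<^sub>i(X) \<circ> dX\<^sup>i\<close>, where the scalar Stratonovich integrals are the limits in probability of
  trapezoidal sums along deterministic partitions of vanishing mesh. Such intervals exhaust \<open>[0,\<infinity>)\<close>,
  so that \<open>I\<close> is unique up to indistinguishability.\<close>

definition is_stratonovich ::
    "('m::topological_space, 'e::euclidean_space) chart set \<Rightarrow> 'w measure \<Rightarrow> (real \<Rightarrow> 'w measure) \<Rightarrow>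
     (real \<Rightarrow> 'w \<Rightarrow> 'm) \<Rightarrow> ('m \<Rightarrow> 'm tvec \<Rightarrow> real) \<Rightarrow> (real \<Rightarrow> 'w \<Rightarrow> real) \<Rightarrow> bool"
  where "is_stratonovich A P F X \<theta> I \<longleftrightarrow>
    (\<forall>t\<ge>0. I t \<in> borel_measurable P) \<and>
    (\<forall>\<omega>\<in>space P. I 0 \<omega> = 0 \<and> continuous_on {0..} (\<lambda>t. I t \<omega>)) \<and>
    (\<forall>(U, \<phi>)\<in>A. \<forall>\<sigma> \<tau>. chart_interval P F X U \<sigma> \<tau> \<longrightarrow>
       (\<forall>t\<ge>0. \<forall>\<epsilon>>0. \<exists>\<delta>>0. \<forall>n r. partition_of t n r \<and> (\<forall>k<n. r (Suc k) - r k < \<delta>) \<longrightarrow>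
          measure P {\<omega>\<in>space P. \<sigma> \<omega> \<le> ereal t \<and>
            \<bar>stratonovich_sum A (U, \<phi>) \<theta> (\<lambda>u. X u \<omega>) n (\<lambda>k. clamp_time (\<sigma> \<omega>) (\<tau> \<omega>) (r k))
             - (I (clamp_time (\<sigma> \<omega>) (\<tau> \<omega>) t) \<omega> - I (real_of_ereal (\<sigma> \<omega>)) \<omega>)\<bar> > \<epsilon>} < \<epsilon>))"

text \<open>\<open>J\<close> is (a continuous version of) the \<open>H\<^sub>1\<close>-valued process with
  \<open>\<langle>\<alpha>, J\<^sub>t\<rangle> = \<integral>\<^sub>0\<^sup>t \<xi>\<^sub>\<alpha> \<circ> dX\<close> for all \<open>\<alpha>\<close>.\<close>

definition is_homology_integral ::
    "('m::topological_space, 'e::euclidean_space) chart set \<Rightarrow> 'w measure \<Rightarrow> (real \<Rightarrow> 'w measure) \<Rightarrow>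
     (real \<Rightarrow> 'w \<Rightarrow> 'm) \<Rightarrow> ('m cohom1 \<Rightarrow> 'm \<Rightarrow> 'm tvec \<Rightarrow> real) \<Rightarrow> (real \<Rightarrow> 'w \<Rightarrow> 'm hom1) \<Rightarrow> bool"
  where "is_homology_integral A P F X \<xi> J \<longleftrightarrow>
    (\<forall>\<alpha>. is_stratonovich A P F X (\<xi> \<alpha>) (\<lambda>t \<omega>. cpair \<alpha> (J t \<omega>)))"

end

theory Submission
  imports Defs
begin

text \<open>Splitting the path at time \<open>s\<close> shows that the defect is the class of the closed chain
  \<open>\<gamma>\<^bsub>z,x\<^esub> - \<gamma>\<^bsub>y,x\<^esub> - \<gamma>\<^bsub>z,y\<^esub>\<close> with \<open>x = X\<^sub>0\<close>, \<open>y = X\<^sub>s\<close>, \<open>z = X\<^sub>s\<^sub>+\<^sub>t\<close>. As it depends on three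
  points only, it can be estimated along deterministic processes: one running through \<open>\<gamma>\<^bsub>x,y\<^esub>\<close> and
  then \<open>\<gamma>\<^bsub>y,z\<^esub>\<close>, and one resting at \<open>y\<close> before running through \<open>\<gamma>\<^bsub>y,z\<^esub>\<close>. On a one-point probability
  space these are semimartingales for which the hypothesis holds surely, so no null sets depending on
  the times or on the cohomology class arise. The Stratonovich integrals of the two processes have the
  same increments along \<open>\<gamma>\<^bsub>y,z\<^esub>\<close>, and cohomology separates the points of homology, so the additive
  functional cancels and three applications of the hypothesis remain.\<close>

section \<open>First homology and its pairing with cohomology\<close>

text \<open>A basis of \<open>S\<close> stays independent when \<open>x\<close> is adjoined, so the
  values 0 on the basis and 1 at \<open>x\<close> extend to a linear functional: the algebraic form
  of Hahn-Banach separation.\<close>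

lemma linear_functional_separating:
  fixes x :: "'a::real_vector"
  assumes S: "subspace S" and x: "x \<notin> S"
  obtains f :: "'a \<Rightarrow> real" where "linear f" "\<And>y. y \<in> S \<Longrightarrow> f y = 0" "f x = 1"
proof -
  obtain B where B: "B \<subseteq> S" "independent B" "S \<subseteq> span B"
    using maximal_independent_subset by metis
  have span: "span B = S"
    using B S by (intro span_subspace)
  then have ind: "independent (insert x B)"
    using B x by (simp add: independent_insertI)
  obtain f :: "'a \<Rightarrow> real" where f: "linear f" "\<And>y. y \<in> insert x B \<Longrightarrow> f y = (if y = x then 1 else 0)"
    using linear_independent_extend[OF ind, of "\<lambda>y. if y = x then 1 else 0 :: real"] by metis
  have zero: "f y = 0" if "y \<in> B" for y
    using f(2)[of y] that B x by auto
  have "f y = 0" if "y \<in> S" for y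
    using linear_eq_0_on_span[OF f(1) zero subsetD[OF B(3) that]] .
  moreover have "f x = 1" using f(2) by simp
  ultimately show ?thesis using f(1) that by metis
qed

text \<open>Boundaries are kept as a subspace of the chains, so that cancellation and separation are
  linear algebra there and classes are taken only at the end.\<close>

definition boundaries1 :: "'a::topological_space rchain set"
  where "boundaries1 = real_boundary 2 ` Collect (real_chain 2)"

lemma subspace_boundaries1: "subspace boundaries1"
proof -
  have "subspace (Collect (real_chain 2))"
    by (auto simp: subspace_def real_chain_0 real_chain_add real_chain_scaleR)
  then show ?thesis
    unfolding boundaries1_def by (rule linear_subspace_image[OF linear_real_boundary])
qed

lemma abs_hom1_eqI: "cycle1 c \<Longrightarrow> cycle1 d \<Longrightarrow> c - d \<in> boundaries1 \<Longrightarrow> abs_hom1 c = abs_hom1 d"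
  unfolding boundaries1_def
  by (rule Quotient3_rel_abs[OF Quotient3_hom1]) (auto simp: homologous1_def)

lemma abs_hom1_diff: "cycle1 c \<Longrightarrow> cycle1 d \<Longrightarrow> abs_hom1 c - abs_hom1 d = abs_hom1 (c - d)"
  by (simp add: minus_hom1.abs_eq eq_onp_def homologous1_refl)

text \<open>Single simplices form a basis of the chains, so a linear functional on chains is the
  evaluation of a cochain. A separating functional thereby becomes a candidate cocycle.\<close>

lemma linear_poly_mapping_eq_cochain_eval:
  fixes f :: "'a rchain \<Rightarrow> real"
  assumes "linear f"
  shows "f c = cochain_eval (\<lambda>\<sigma>. f (Poly_Mapping.single \<sigma> 1)) c"
proof -
  have "c = (\<Sum>\<sigma>\<in>Poly_Mapping.keys c. Poly_Mapping.lookup c \<sigma> *\<^sub>R Poly_Mapping.single \<sigma> 1)"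
    by (rule poly_mapping_eqI)
      (auto simp: lookup_sum lookup_scaleR lookup_single when_def in_keys_iff if_distrib
        sum.delta cong: if_cong)
  then have "f c = f (\<Sum>\<sigma>\<in>Poly_Mapping.keys c. Poly_Mapping.lookup c \<sigma> *\<^sub>R Poly_Mapping.single \<sigma> 1)"
    by (rule arg_cong)
  then show ?thesis
    by (simp add: linear_sum[OF assms] linear_scale[OF assms] cochain_eval_def)
qed

lemma cpair_abs:
  "cocycle1 \<phi> \<Longrightarrow> cycle1 c \<Longrightarrow> cpair (abs_cohom1 \<phi>) (abs_hom1 c) = cochain_eval \<phi> c"
  by (simp add: cpair.abs_eq cohomologous1_refl homologous1_refl)

lemma hom1_cases:
  obtains c where "cycle1 c" "h = abs_hom1 c"
proof
  show "cycle1 (rep_hom1 h)"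
    using Quotient3_rep_reflp[OF Quotient3_hom1, of h] by (simp add: homologous1_def)
  show "h = abs_hom1 (rep_hom1 h)"
    using Quotient3_abs_rep[OF Quotient3_hom1, of h] by simp
qed

lemma cohom1_cases:
  obtains \<phi> where "cocycle1 \<phi>" "\<alpha> = abs_cohom1 \<phi>"
proof
  show "cocycle1 (rep_cohom1 \<alpha>)"
    using Quotient3_rep_reflp[OF Quotient3_cohom1, of \<alpha>] by (simp add: cohomologous1_def)
  show "\<alpha> = abs_cohom1 (rep_cohom1 \<alpha>)"
    using Quotient3_abs_rep[OF Quotient3_cohom1, of \<alpha>] by simp
qed

lemma cpair_diff: "cpair \<alpha> (h - h') = cpair \<alpha> h - cpair \<alpha> h'"
proof -
  obtain c where "cycle1 c" "h = abs_hom1 c" by (rule hom1_cases)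
  moreover obtain c' where "cycle1 c'" "h' = abs_hom1 c'" by (rule hom1_cases)
  moreover obtain \<phi> where "cocycle1 \<phi>" "\<alpha> = abs_cohom1 \<phi>" by (rule cohom1_cases)
  moreover from calculation have "cycle1 (c - c')"
    using cycle1_add[OF _ cycle1_scaleR[of c' "-1"], of c] by simp
  ultimately show ?thesis
    by (simp add: abs_hom1_diff cpair_abs linear_diff[OF linear_cochain_eval])
qed

text \<open>The universal coefficient theorem over a field: the functional that separates a cycle from
  the boundaries is itself a cocycle.\<close>

lemma cpair_nondegenerate:
  assumes "\<And>\<alpha>. cpair \<alpha> h = 0"
  shows "h = 0"
proof (rule ccontr)
  assume "h \<noteq> 0"
  obtain c where c: "cycle1 c" "h = abs_hom1 c" by (rule hom1_cases)
  have "c \<notin> boundaries1"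
    using abs_hom1_eqI[OF c(1) cycle1_0] c(2) \<open>h \<noteq> 0\<close> by (auto simp: zero_hom1_def)
  then obtain f :: "'a rchain \<Rightarrow> real"
    where f: "linear f" "\<And>d. d \<in> boundaries1 \<Longrightarrow> f d = 0" "f c = 1"
    using linear_functional_separating[OF subspace_boundaries1] by metis
  define \<phi> where "\<phi> = (\<lambda>\<sigma>. f (Poly_Mapping.single \<sigma> 1))"
  note eval = linear_poly_mapping_eq_cochain_eval[OF f(1), folded \<phi>_def]
  \<comment> \<open>The coboundary of \<phi> at \<sigma> is \<open>f\<close> of the boundary of
    \<sigma>, and \<open>f\<close> kills boundaries.\<close>
  have "coboundary 1 \<phi> \<sigma> = 0" if "singular_simplex 2 euclidean \<sigma>" for \<sigma>
  proof -
    have "real_chain 2 (Poly_Mapping.single \<sigma> 1)"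
      using that by (simp add: real_chain_def)
    then have "f (real_boundary 2 (Poly_Mapping.single \<sigma> 1)) = 0"
      by (intro f) (auto simp: boundaries1_def)
    then show ?thesis
      using cochain_eval_boundary[of \<phi> 1 "Poly_Mapping.single \<sigma> 1"]
      by (simp add: eval cochain_eval_single numeral_2_eq_2)
  qed
  then have "cocycle1 \<phi>" by (simp add: cocycle1_def)
  \<comment> \<open>Pairing the class of \<phi> with \<open>h\<close> gives \<open>f c = 1\<close>,
    against the assumption that every pairing vanishes.\<close>
  then show False
    using assms[of "abs_cohom1 \<phi>"] c f(3) by (simp add: cpair_abs flip: eval)
qed

section \<open>Singular chains carried by paths\<close>

lemma real_boundary_single:
  "real_boundary p (Poly_Mapping.single \<sigma> 1) =
    (\<Sum>k\<le>p. Poly_Mapping.single (singular_face p k \<sigma>) ((-1) ^ k))"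
  by (simp add: real_boundary_def)

lemma continuous_on_coordinate: "continuous_on S (\<lambda>x::nat \<Rightarrow> real. x i)"
  using continuous_on_product_coordinates[of i] continuous_on_subset by blast

text \<open>Paths that are not closed also become chains in this way, and sums of such chains
  replace joins of paths.\<close>

definition path_chain :: "(real \<Rightarrow> 'a) \<Rightarrow> 'a rchain"
  where "path_chain c = Poly_Mapping.single (path_simplex c) 1"

lemma path_chain_cong: "(\<And>u. u \<in> {0..1} \<Longrightarrow> c u = c' u) \<Longrightarrow> path_chain c = path_chain c'"
  unfolding path_chain_def path_simplex_def
  by (rule arg_cong[where f = "\<lambda>\<sigma>. Poly_Mapping.single \<sigma> 1"], rule restrict_ext)
    (auto simp: standard_simplex_def)

text \<open>Singular simplices are extensional functions, so comparing faces requires the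
  restriction to be moved outside. The bound on \<open>k\<close> makes the face map land in the
  larger simplex, where the inner restriction is invisible.\<close>

lemma singular_face_restrict:
  assumes "k \<le> Suc p"
  shows "singular_face (Suc p) k (restrict f (standard_simplex (Suc p))) =
    restrict (\<lambda>x. f (simplical_face k x)) (standard_simplex p)"
  unfolding singular_face_def
  using simplical_face_in_standard_simplex[of "Suc p" k] assms
  by (intro restrict_ext[of _ _ _, simplified] ext) (auto simp: restrict_def)

lemma singular_simplex_restrictI:
  "continuous_on (standard_simplex p) f \<Longrightarrow>
    singular_simplex p euclidean (restrict f (standard_simplex p))"
  by (auto simp: singular_simplex_def euclidean_product_topology intro: continuous_map_eq[of _ _ f])

lemma singular_simplex_path_simplex:
  assumes "path c"
  shows "singular_simplex 1 euclidean (path_simplex c)"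
  unfolding path_simplex_def
proof (rule singular_simplex_restrictI, rule continuous_on_compose2[of "{0..1}" c])
  show "continuous_on {0..1} c" using assms by (simp add: path_def)
qed (auto simp: standard_simplex_def continuous_on_coordinate)

definition point_chain :: "'a \<Rightarrow> 'a rchain"
  where "point_chain x = Poly_Mapping.single (restrict (\<lambda>_. x) (standard_simplex 0)) 1"

text \<open>Face 0 drops vertex 0 and leaves the parameter value 1, so it is the final point; face 1
  is the initial point and carries the sign -1.\<close>

lemma real_boundary_path_chain:
  "real_boundary 1 (path_chain c) = point_chain (pathfinish c) - point_chain (pathstart c)"
proof -
  have "singular_face 1 0 (path_simplex c) = restrict (\<lambda>_. pathfinish c) (standard_simplex 0)"
      "singular_face 1 1 (path_simplex c) = restrict (\<lambda>_. pathstart c) (standard_simplex 0)"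
    unfolding path_simplex_def One_nat_def singular_face_restrict[OF le0]
      singular_face_restrict[OF order_refl]
    by (rule restrict_ext,
        simp add: standard_simplex_0 simplical_face_def pathstart_def pathfinish_def)+
  then show ?thesis
    by (simp add: path_chain_def point_chain_def real_boundary_single atMost_Suc single_uminus)
qed

lemma real_chain_path_chain: "path c \<Longrightarrow> real_chain 1 (path_chain c)"
  using singular_simplex_path_simplex by (auto simp: real_chain_def path_chain_def)

lemma cycle1_diff: "cycle1 c \<Longrightarrow> cycle1 d \<Longrightarrow> cycle1 (c - d)"
  using cycle1_add[OF _ cycle1_scaleR[of d "-1"], of c] by simp

lemmas real_boundary_linear = linear_add[OF linear_real_boundary] linear_diff[OF linear_real_boundary]

lemma standard_simplex_2D:
  assumes "x \<in> standard_simplex 2"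
  shows "0 \<le> x 0" "0 \<le> x 1" "0 \<le> x 2" "x 0 = 1 - x 1 - x 2"
  using assms by (auto simp: standard_simplex_def numeral_2_eq_2)

text \<open>The piece of \<open>c\<close> over [a,b], reparametrised affinely to the unit interval;
  \<open>a = b\<close> gives a constant path.\<close>

definition path_on :: "real \<Rightarrow> real \<Rightarrow> (real \<Rightarrow> 'a) \<Rightarrow> real \<Rightarrow> 'a"
  where "path_on a b c u = c (a + (b - a) * u)"

text \<open>The singular triangle obtained by composing \<open>c\<close> with the affine map that
  sends the vertices to \<open>a\<close>, \<open>b\<close>, \<open>d\<close> has the three pieces as
  its faces, so its boundary is the stated combination.\<close>

lemma path_on_chain_add:
  assumes "a \<le> b" "b \<le> d" and c: "continuous_on {a..d} c"
  shows "path_chain (path_on a b c) + path_chain (path_on b d c) - path_chain (path_on a d c)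
    \<in> boundaries1"
proof -
  let ?p = "\<lambda>x::nat \<Rightarrow> real. a * x 0 + b * x 1 + d * x 2"
  define \<tau> where "\<tau> = restrict (\<lambda>x. c (?p x)) (standard_simplex 2)"
  have range: "?p x \<in> {a..d}" if "x \<in> standard_simplex 2" for x
  proof -
    note x = standard_simplex_2D[OF that]
    \<comment> \<open>As the barycentric coordinates sum to 1, the distances to both ends are
      combinations of coordinates with nonnegative coefficients.\<close>
    have "?p x - a = (b - a) * x 1 + (d - a) * x 2" "d - ?p x = (d - a) * x 0 + (d - b) * x 1"
      by (simp_all add: x(4) algebra_simps)
    moreover have "0 \<le> (b - a) * x 1 + (d - a) * x 2" "0 \<le> (d - a) * x 0 + (d - b) * x 1"
      using x(1-3) assms by simp_all
    ultimately show ?thesis by simp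
  qed
  have "singular_simplex 2 euclidean \<tau>"
    unfolding \<tau>_def
  proof (rule singular_simplex_restrictI, rule continuous_on_compose2[OF c])
    show "continuous_on (standard_simplex 2) ?p" by (intro continuous_intros continuous_on_coordinate)
  qed (use range in auto)
  then have \<tau>: "real_chain 2 (Poly_Mapping.single \<tau> 1)" by (simp add: real_chain_def)
  have face: "singular_face 2 k \<tau> = restrict (\<lambda>x. c (?p (simplical_face k x))) (standard_simplex 1)"
    if "k \<le> 2" for k
    using singular_face_restrict[of k 1] that by (simp add: \<tau>_def numeral_2_eq_2)
  \<comment> \<open>Face \<open>k\<close> omits vertex \<open>k\<close>, so the parameter runs
    affinely between the two remaining vertices.\<close>
  have coords: "?p (simplical_face 0 x) = b + (d - b) * x 1"
      "?p (simplical_face 1 x) = a + (d - a) * x 1"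
      "?p (simplical_face 2 x) = a + (b - a) * x 1" if "x \<in> standard_simplex 1" for x
  proof -
    have x: "x 0 = 1 - x 1" using that by (auto simp: standard_simplex_def)
    show "?p (simplical_face 0 x) = b + (d - b) * x 1"
      "?p (simplical_face 1 x) = a + (d - a) * x 1"
      "?p (simplical_face 2 x) = a + (b - a) * x 1"
      by (simp_all add: simplical_face_def x[simplified] algebra_simps)
  qed
  have f: "singular_face 2 0 \<tau> = path_simplex (path_on b d c)"
      "singular_face 2 1 \<tau> = path_simplex (path_on a d c)"
      "singular_face 2 2 \<tau> = path_simplex (path_on a b c)"
    unfolding path_simplex_def path_on_def face[OF zero_le] face[OF one_le_numeral] face[OF order_refl]
    by (rule restrict_ext, simp only: coords)+
  have "real_boundary 2 (Poly_Mapping.single \<tau> 1) =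
      path_chain (path_on a b c) + path_chain (path_on b d c) - path_chain (path_on a d c)"
    by (simp add: real_boundary_single numeral_2_eq_2 atMost_Suc path_chain_def
        f[unfolded numeral_2_eq_2 One_nat_def] single_uminus)
  then show ?thesis using \<tau> unfolding boundaries1_def
    by (intro image_eqI[where x = "Poly_Mapping.single \<tau> 1"]) simp_all
qed

text \<open>The subdivision identity for the joined path, cut at 1/2, where a join changes
  over.\<close>

lemma join_chain_add:
  assumes "path p" "path q" "pathfinish p = pathstart q"
  shows "path_chain p + path_chain q - path_chain (p +++ q) \<in> boundaries1"
proof -
  have "path (p +++ q)" using assms by simp
  then have "path_chain (path_on 0 (1/2) (p +++ q)) + path_chain (path_on (1/2) 1 (p +++ q))
      - path_chain (path_on 0 1 (p +++ q)) \<in> boundaries1"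
    by (intro path_on_chain_add) (auto simp: path_def)
  moreover have "path_chain (path_on 0 (1/2) (p +++ q)) = path_chain p"
    by (rule path_chain_cong) (auto simp: path_on_def joinpaths_def)
  moreover have "path_chain (path_on (1/2) 1 (p +++ q)) = path_chain q"
    using assms(3)
    by (intro path_chain_cong) (auto simp: path_on_def joinpaths_def pathstart_def pathfinish_def)
  moreover have "path_chain (path_on 0 1 (p +++ q)) = path_chain (p +++ q)"
    by (rule path_chain_cong) (simp add: path_on_def)
  ultimately show ?thesis by simp
qed


section \<open>The defect of the homology process\<close>

text \<open>The loop in the definition is a join; replacing it by a sum of two chains makes the
  class additive in its pieces. The cycle statement is recorded because class arithmetic is
  available for cycles only.\<close>

lemma homology_process_eq:
  fixes X :: "real \<Rightarrow> 'm::topological_space"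
  assumes "t > 0" and X: "continuous_on {0..t} X"
    and \<gamma>: "path (\<gamma> (X t) (X 0))" "pathstart (\<gamma> (X t) (X 0)) = X t" "pathfinish (\<gamma> (X t) (X 0)) = X 0"
  shows "cycle1 (path_chain (path_on 0 t X) + path_chain (\<gamma> (X t) (X 0)))"
    and "homology_process \<gamma> t X = abs_hom1 (path_chain (path_on 0 t X) + path_chain (\<gamma> (X t) (X 0)))"
proof -
  let ?p = "path_on 0 t X" and ?q = "\<gamma> (X t) (X 0)"
  have p: "path ?p" "pathstart ?p = X 0" "pathfinish ?p = X t"
    using \<open>t > 0\<close> unfolding path_def path_on_def pathstart_def pathfinish_def
    by (auto intro!: continuous_on_compose2[OF X] continuous_intros simp: mult_left_le)
  show 1: "cycle1 (path_chain ?p + path_chain ?q)"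
    by (simp add: cycle1_def real_chain_add real_chain_path_chain p \<gamma> real_boundary_linear
        real_boundary_path_chain del: One_nat_def)
  have 2: "cycle1 (path_chain (?p +++ ?q))"
    using p \<gamma> by (simp add: cycle1_def real_chain_path_chain real_boundary_path_chain del: One_nat_def)
  have "path_chain ?p + path_chain ?q - path_chain (?p +++ ?q) \<in> boundaries1"
    using p \<gamma> by (intro join_chain_add) auto
  then have "abs_hom1 (path_chain (?p +++ ?q)) = abs_hom1 (path_chain ?p + path_chain ?q)"
    using abs_hom1_eqI[OF 1 2] by simp
  moreover have "(\<lambda>u. X (t * u)) = ?p" by (auto simp: path_on_def)
  ultimately show "homology_process \<gamma> t X = abs_hom1 (path_chain ?p + path_chain ?q)"
    using \<open>t > 0\<close> by (simp add: homology_process_def loop_class_def path_chain_def)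
qed

text \<open>The direct closing path from \<open>z\<close> to \<open>x\<close> minus the detour from
  \<open>z\<close> through \<open>y\<close> to \<open>x\<close>; for a closing family the endpoints
  cancel, so this is a cycle.\<close>

definition triangle_class :: "('m::topological_space \<Rightarrow> 'm \<Rightarrow> real \<Rightarrow> 'm) \<Rightarrow> 'm \<Rightarrow> 'm \<Rightarrow> 'm \<Rightarrow> 'm hom1"
  where "triangle_class \<gamma> x y z =
    abs_hom1 (path_chain (\<gamma> z x) - path_chain (\<gamma> y x) - path_chain (\<gamma> z y))"

definition closing_family :: "('m::topological_space \<Rightarrow> 'm \<Rightarrow> real \<Rightarrow> 'm) \<Rightarrow> bool"
  where "closing_family \<gamma> \<longleftrightarrow>
    (\<forall>x y. path (\<gamma> x y) \<and> pathstart (\<gamma> x y) = x \<and> pathfinish (\<gamma> x y) = y)"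

text \<open>Subdivision at time \<open>s\<close> makes the three chains of \<open>X\<close> cancel
  up to a boundary, leaving the closing paths alone. Both times are positive because the value at
  time 0 is 0 by convention and does not contain the loop \<open>\<gamma> x x\<close>.\<close>

lemma homology_process_defect:
  fixes X :: "real \<Rightarrow> 'm::topological_space"
  assumes \<gamma>: "closing_family \<gamma>" and X: "continuous_on {0..} X" and st: "s > 0" "t > 0"
  shows "homology_process \<gamma> (s + t) X - homology_process \<gamma> s X - homology_process \<gamma> t (time_shift s X)
    = triangle_class \<gamma> (X 0) (X s) (X (s + t))"
proof -
  note g = \<gamma>[unfolded closing_family_def, rule_format]
  have shift: "path_on 0 t (time_shift s X) = path_on s (s + t) X"
      "time_shift s X 0 = X s" "time_shift s X t = X (s + t)"
    by (auto simp: path_on_def time_shift_def)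
  have Xs: "continuous_on {0..t} (time_shift s X)"
    unfolding time_shift_def using st
    by (intro continuous_on_compose2[OF X] continuous_intros) auto
  have Xr: "continuous_on {0..r} X" for r
    by (rule continuous_on_subset[OF X]) auto
  have h: "cycle1 (path_chain (path_on 0 (s + t) X) + path_chain (\<gamma> (X (s + t)) (X 0)))"
      "homology_process \<gamma> (s + t) X =
        abs_hom1 (path_chain (path_on 0 (s + t) X) + path_chain (\<gamma> (X (s + t)) (X 0)))"
      "cycle1 (path_chain (path_on 0 s X) + path_chain (\<gamma> (X s) (X 0)))"
      "homology_process \<gamma> s X = abs_hom1 (path_chain (path_on 0 s X) + path_chain (\<gamma> (X s) (X 0)))"
      "cycle1 (path_chain (path_on s (s + t) X) + path_chain (\<gamma> (X (s + t)) (X s)))"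
      "homology_process \<gamma> t (time_shift s X) =
        abs_hom1 (path_chain (path_on s (s + t) X) + path_chain (\<gamma> (X (s + t)) (X s)))"
    using homology_process_eq[where \<gamma> = \<gamma> and t = "s + t" and X = X]
      homology_process_eq[where \<gamma> = \<gamma> and t = s and X = X]
      homology_process_eq[where \<gamma> = \<gamma> and t = t and X = "time_shift s X"]
    by (simp_all add: st g shift Xr Xs add_pos_pos)
  have "path_chain (path_on 0 s X) + path_chain (path_on s (s + t) X)
      - path_chain (path_on 0 (s + t) X) \<in> boundaries1"
    using st by (intro path_on_chain_add Xr) auto
  then have "- (path_chain (path_on 0 s X) + path_chain (path_on s (s + t) X)
      - path_chain (path_on 0 (s + t) X)) \<in> boundaries1"
    by (rule subspace_neg[OF subspace_boundaries1])
  then have "(path_chain (path_on 0 (s + t) X) + path_chain (\<gamma> (X (s + t)) (X 0))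
      - (path_chain (path_on 0 s X) + path_chain (\<gamma> (X s) (X 0)))
      - (path_chain (path_on s (s + t) X) + path_chain (\<gamma> (X (s + t)) (X s))))
    - (path_chain (\<gamma> (X (s + t)) (X 0)) - path_chain (\<gamma> (X s) (X 0)) - path_chain (\<gamma> (X (s + t)) (X s)))
    \<in> boundaries1"
    by (simp add: algebra_simps)
  moreover have "cycle1 (path_chain (\<gamma> (X (s + t)) (X 0)) - path_chain (\<gamma> (X s) (X 0))
      - path_chain (\<gamma> (X (s + t)) (X s)))"
    by (simp add: g cycle1_def real_chain_diff real_chain_path_chain real_boundary_linear
        real_boundary_path_chain del: One_nat_def)
  ultimately have "abs_hom1 (path_chain (path_on 0 (s + t) X) + path_chain (\<gamma> (X (s + t)) (X 0))
      - (path_chain (path_on 0 s X) + path_chain (\<gamma> (X s) (X 0)))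
      - (path_chain (path_on s (s + t) X) + path_chain (\<gamma> (X (s + t)) (X s))))
    = triangle_class \<gamma> (X 0) (X s) (X (s + t))"
    unfolding triangle_class_def
    by (intro abs_hom1_eqI cycle1_diff[OF cycle1_diff[OF h(1,3)] h(5)])
  then show ?thesis
    unfolding h(2,4,6) by (simp only: abs_hom1_diff cycle1_diff h(1,3,5))
qed

text \<open>The closing loop at the resting point may be nontrivial. It appears as the class at time
  \<open>s\<close> and, with the opposite sign, as the triangle class, so the two cancel in the
  defect formula.\<close>

lemma homology_process_constant_start:
  fixes X :: "real \<Rightarrow> 'm::topological_space"
  assumes \<gamma>: "closing_family \<gamma>" and X: "continuous_on {0..} X" and st: "s > 0" "t > 0"
    and const: "\<And>u. 0 \<le> u \<Longrightarrow> u \<le> s \<Longrightarrow> X u = X 0"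
  shows "homology_process \<gamma> (s + t) X = homology_process \<gamma> t (time_shift s X)"
proof -
  note g = \<gamma>[unfolded closing_family_def, rule_format]
  have Xr: "continuous_on {0..s} X" by (rule continuous_on_subset[OF X]) auto
  \<comment> \<open>The identity for the subdivision with all three times 0 has the form
    \<open>c + c - c\<close>, so a constant path is a boundary.\<close>
  have "path_chain (path_on 0 0 X) + path_chain (path_on 0 0 X) - path_chain (path_on 0 0 X)
      \<in> boundaries1"
    by (rule path_on_chain_add) auto
  moreover have "path_chain (path_on 0 s X) = path_chain (path_on 0 0 X)"
    using st by (intro path_chain_cong) (simp add: path_on_def const[of "s * _"] mult_left_le)
  ultimately have b: "path_chain (path_on 0 s X) \<in> boundaries1"
    by simp
  have [simp]: "X s = X 0" by (rule const) (use st in auto)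
  have cyc: "cycle1 (path_chain (\<gamma> x x))" for x
    using g by (simp add: cycle1_def real_chain_path_chain real_boundary_path_chain del: One_nat_def)
  have h: "cycle1 (path_chain (path_on 0 s X) + path_chain (\<gamma> (X 0) (X 0)))"
      "homology_process \<gamma> s X = abs_hom1 (path_chain (path_on 0 s X) + path_chain (\<gamma> (X 0) (X 0)))"
    using homology_process_eq[where \<gamma> = \<gamma>, OF st(1) Xr] by (simp_all add: g)
  have "homology_process \<gamma> s X = abs_hom1 (path_chain (\<gamma> (X 0) (X 0)))"
    unfolding h(2) using b by (intro abs_hom1_eqI h(1) cyc) simp
  moreover have "triangle_class \<gamma> (X 0) (X s) (X (s + t)) = abs_hom1 (0 - path_chain (\<gamma> (X 0) (X 0)))"
    by (simp add: triangle_class_def)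
  then have "triangle_class \<gamma> (X 0) (X s) (X (s + t)) = 0 - abs_hom1 (path_chain (\<gamma> (X 0) (X 0)))"
    unfolding abs_hom1_diff[OF cycle1_0 cyc, symmetric] zero_hom1_def .
  ultimately show ?thesis
    using homology_process_defect[OF assms(1-4)] by simp
qed

lemma homology_process_cong:
  assumes "t \<ge> 0" "\<And>u. u \<ge> 0 \<Longrightarrow> X u = X' u"
  shows "homology_process \<gamma> t X = homology_process \<gamma> t X'"
proof -
  have "path_chain ((\<lambda>u. X (t * u)) +++ \<gamma> (X t) (X 0)) = path_chain ((\<lambda>u. X' (t * u)) +++ \<gamma> (X' t) (X' 0))"
    using assms by (intro path_chain_cong) (auto simp: joinpaths_def)
  then show ?thesis by (simp add: homology_process_def loop_class_def path_chain_def)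
qed


section \<open>Deterministic semimartingales\<close>

text \<open>This condition holds for piecewise smooth paths, survives corners and concatenation, and
  gives coordinates of finite variation. The constant may depend on the chart and the
  subinterval.\<close>

definition chart_lipschitz ::
    "('m::topological_space, 'e::euclidean_space) chart set \<Rightarrow> (real \<Rightarrow> 'm) \<Rightarrow> real \<Rightarrow> real \<Rightarrow> bool"
  where "chart_lipschitz A c p q \<longleftrightarrow> (\<forall>(U, \<phi>)\<in>A. \<forall>a b. p \<le> a \<and> a \<le> b \<and> b \<le> q \<and> c ` {a..b} \<subseteq> U \<longrightarrow>
    (\<exists>B. B-lipschitz_on {a..b} (\<phi> \<circ> c)))"

lemma chart_lipschitzD:
  "chart_lipschitz A c p q \<Longrightarrow> (U, \<phi>) \<in> A \<Longrightarrow> p \<le> a \<Longrightarrow> a \<le> b \<Longrightarrow> b \<le> q \<Longrightarrow> c ` {a..b} \<subseteq> U \<Longrightarrow>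
    \<exists>B. B-lipschitz_on {a..b} (\<phi> \<circ> c)"
  unfolding chart_lipschitz_def by blast

lemma chart_lipschitz_cong:
  assumes "chart_lipschitz A c p q" "\<And>t. p \<le> t \<Longrightarrow> t \<le> q \<Longrightarrow> c' t = c t"
  shows "chart_lipschitz A c' p q"
  unfolding chart_lipschitz_def
proof clarify
  fix U \<phi> a b
  assume h: "(U, \<phi>) \<in> A" "p \<le> a" "a \<le> b" "b \<le> q" "c' ` {a..b} \<subseteq> U"
  have eq: "c' t = c t" if "t \<in> {a..b}" for t using that h assms(2) by auto
  then have "c ` {a..b} \<subseteq> U" using h(5) by (metis image_cong)
  then obtain B where "B-lipschitz_on {a..b} (\<phi> \<circ> c)"
    using chart_lipschitzD[OF assms(1) h(1-4)] by blast
  then have "B-lipschitz_on {a..b} (\<phi> \<circ> c')"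
    by (rule lipschitz_on_transform) (simp add: eq)
  then show "\<exists>B. B-lipschitz_on {a..b} (\<phi> \<circ> c')" ..
qed

text \<open>A subinterval containing \<open>q\<close> is cut there, and the larger of the two
  constants serves on both sides.\<close>

lemma chart_lipschitz_join:
  assumes "chart_lipschitz A c p q" "chart_lipschitz A c q r"
  shows "chart_lipschitz A c p r"
  unfolding chart_lipschitz_def
proof clarify
  fix U \<phi> a b
  assume h: "(U, \<phi>) \<in> A" "p \<le> a" "a \<le> b" "b \<le> r" "c ` {a..b} \<subseteq> U"
  consider "b \<le> q" | "q \<le> a" | "a \<le> q" "q \<le> b" by linarith
  then show "\<exists>B. B-lipschitz_on {a..b} (\<phi> \<circ> c)"
  proof cases
    case 1 then show ?thesis using chart_lipschitzD[OF assms(1)] h by blast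
  next
    case 2 then show ?thesis using chart_lipschitzD[OF assms(2)] h by blast
  next
    case 3
    have "c ` {a..q} \<subseteq> U" "c ` {q..b} \<subseteq> U" using h(5) 3 by auto
    then obtain B B' where "B-lipschitz_on {a..q} (\<phi> \<circ> c)" "B'-lipschitz_on {q..b} (\<phi> \<circ> c)"
      using chart_lipschitzD[OF assms(1) h(1)] chart_lipschitzD[OF assms(2) h(1)] h 3
      by (metis order_refl)
    from lipschitz_on_concat_max[OF this] show ?thesis
      by (auto intro!: exI[of _ "max B B'"] cong: if_cong)
  qed
qed

lemma chart_lipschitz_shift:
  assumes "chart_lipschitz A c p q"
  shows "chart_lipschitz A (\<lambda>t. c (t - h)) (p + h) (q + h)"
  unfolding chart_lipschitz_def
proof clarify
  fix U \<phi> a b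
  assume h: "(U, \<phi>) \<in> A" "p + h \<le> a" "a \<le> b" "b \<le> q + h" "(\<lambda>t. c (t - h)) ` {a..b} \<subseteq> U"
  have im: "(\<lambda>t. t - h) ` {a..b} = {a - h..b - h}"
    by (simp add: image_diff_atLeastAtMost)
  have "c ` {a - h..b - h} \<subseteq> U" using h(5) unfolding im[symmetric] image_image .
  then obtain B where "B-lipschitz_on {a - h..b - h} (\<phi> \<circ> c)"
    using chart_lipschitzD[OF assms h(1), of "a - h" "b - h"] h by auto
  then have "(B * 1)-lipschitz_on {a..b} (\<lambda>t. (\<phi> \<circ> c) (t - h))"
    by (intro lipschitz_on_compose2) (auto simp: im lipschitz_on_def dist_real_def)
  then show "\<exists>B. B-lipschitz_on {a..b} (\<phi> \<circ> (\<lambda>t. c (t - h)))"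
    by (auto simp: o_def)
qed

lemma chart_lipschitz_const: "chart_lipschitz A (\<lambda>_. x) p q"
  unfolding chart_lipschitz_def by (auto simp: o_def intro!: exI[of _ 0] lipschitz_on_constant)

text \<open>The coordinate derivative of the smooth extension is continuous on a compact interval,
  hence bounded, and the mean value inequality applies.\<close>

lemma chart_lipschitz_smooth:
  assumes "\<forall>(U, \<phi>)\<in>A. open U" and "smooth_path_on A c p q"
  shows "chart_lipschitz A c p q"
  unfolding chart_lipschitz_def
proof clarify
  fix U \<phi> a b
  assume h: "(U, \<phi>) \<in> A" "p \<le> a" "a \<le> b" "b \<le> q" "c ` {a..b} \<subseteq> U"
  obtain c' W where c': "open W" "{p..q} \<subseteq> W" "\<And>t. t \<in> {p..q} \<Longrightarrow> c' t = c t"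
      "smooth_on (W \<inter> c' -` U) (\<phi> \<circ> c')"
    using assms(2) h(1) unfolding smooth_path_on_def by fast
  let ?S = "W \<inter> c' -` U" and ?f = "\<phi> \<circ> c'"
  have sub: "{a..b} \<subseteq> ?S" using h c'(2,3) by fastforce
  have "Ck_on (Suc 0) ?S ?f" using c'(4) unfolding smooth_on_def by blast
  then have f: "\<And>x. x \<in> ?S \<Longrightarrow> ?f differentiable (at x)"
      and cont: "continuous_on ?S (\<lambda>x. frechet_derivative ?f (at x) 1)"
    by auto
  have "bounded ((\<lambda>x. frechet_derivative ?f (at x) 1) ` {a..b})"
    using continuous_on_subset[OF cont sub] by (intro compact_imp_bounded compact_continuous_image) auto
  then obtain B where B: "B > 0" "\<And>x. x \<in> {a..b} \<Longrightarrow> norm (frechet_derivative ?f (at x) 1) \<le> B"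
    unfolding bounded_pos by auto
  have "B-lipschitz_on {a..b} ?f"
  proof (rule bounded_derivative_imp_lipschitz)
    fix x assume x: "x \<in> {a..b}"
    have der: "(?f has_derivative frechet_derivative ?f (at x)) (at x)"
      using f sub x frechet_derivative_works by blast
    then show "(?f has_derivative frechet_derivative ?f (at x)) (at x within {a..b})"
      by (rule has_derivative_at_withinI)
    \<comment> \<open>On the real line a derivative is determined by its value at 1, so the bound
      there bounds the operator norm.\<close>
    have "frechet_derivative ?f (at x) r = r *\<^sub>R frechet_derivative ?f (at x) 1" for r
      using linear_scale[OF has_derivative_linear[OF der], of r 1] by simp
    then have "norm (frechet_derivative ?f (at x) r) \<le> B * norm r" for r
      using mult_left_mono[OF B(2)[OF x], of "\<bar>r\<bar>"] by (metis norm_scaleR real_norm_def abs_ge_zero mult.commute)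
    then show "onorm (frechet_derivative ?f (at x)) \<le> B" by (rule onorm_le)
  qed (use B in auto)
  then have "B-lipschitz_on {a..b} (\<phi> \<circ> c)"
    using h c'(3) by (elim lipschitz_on_transform) auto
  then show "\<exists>B. B-lipschitz_on {a..b} (\<phi> \<circ> c)" ..
qed

lemma chart_lipschitz_piecewise_smooth:
  assumes A: "\<forall>(U, \<phi>)\<in>A. open U" and "piecewise_smooth_path A c"
  shows "chart_lipschitz A c 0 1"
proof -
  obtain n r where r: "r 0 = 0" "r n = 1"
      "\<And>k. k < n \<Longrightarrow> r k < r (Suc k) \<and> smooth_path_on A c (r k) (r (Suc k))"
    using assms(2) unfolding piecewise_smooth_path_def by auto
  have "chart_lipschitz A c (r 0) (r k)" if "k \<le> n" for k
    using that
  proof (induction k)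
    case 0
    \<comment> \<open>On a one-point interval every path agrees with a constant one.\<close>
    have "chart_lipschitz A (\<lambda>_. c (r 0)) (r 0) (r 0)" by (rule chart_lipschitz_const)
    then show ?case by (rule chart_lipschitz_cong) (metis order_antisym)
  next
    case (Suc k)
    have "chart_lipschitz A c (r k) (r (Suc k))"
      using Suc.prems r(3)[of k] by (intro chart_lipschitz_smooth[OF A]) simp
    with Suc show ?case by (intro chart_lipschitz_join[of A c "r 0" "r k" "r (Suc k)"]) simp_all
  qed
  from this[of n] show ?thesis by (simp add: r(1,2))
qed

section \<open>Deterministic processes on a one-point probability space\<close>

definition dirac :: "'w \<Rightarrow> 'w measure"
  where "dirac w = return (count_space {w}) w"

lemma space_dirac [simp]: "space (dirac w) = {w}"
  and sets_dirac [simp]: "sets (dirac w) = Pow {w}"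
  by (simp_all add: dirac_def)

lemma prob_space_dirac: "prob_space (dirac w)"
  by (simp add: dirac_def prob_space_return)

lemma measurable_dirac: "f w \<in> space N \<Longrightarrow> f \<in> measurable (dirac w) N"
  by (auto simp: measurable_def)

lemma AE_dirac: "(AE v in dirac w. Q v) \<longleftrightarrow> Q w"
  unfolding dirac_def by (subst AE_return) auto

lemma measure_dirac: "S \<subseteq> {w} \<Longrightarrow> measure (dirac w) S = indicator S w"
  unfolding dirac_def by (subst measure_return) auto

lemma subalgebra_dirac: "subalgebra (dirac w) (dirac w)"
  by (simp add: subalgebra_def)

lemma filtered_prob_space_dirac: "filtered_prob_space (dirac w) (\<lambda>_. dirac w)"
  by (simp add: filtered_prob_space_def prob_space_dirac subalgebra_dirac filtration_def)

lemma continuous_adapted_dirac: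
  "continuous_on {0..} (\<lambda>t. Y t w) \<Longrightarrow> continuous_adapted (dirac w) (\<lambda>_. dirac w) Y"
  by (simp add: continuous_adapted_def measurable_dirac)

lemma ext_stopping_time_dirac: "0 \<le> \<tau> w \<Longrightarrow> ext_stopping_time (dirac w) (\<lambda>_. dirac w) \<tau>"
  by (auto simp: ext_stopping_time_def pred_def)

lemma is_martingale_zero_dirac: "is_martingale (dirac w) (\<lambda>_. dirac w) (\<lambda>_ _. 0)"
proof -
  interpret prob_space "dirac w" by (rule prob_space_dirac)
  have "finite_measure_subalgebra (dirac w) (dirac w)"
    by unfold_locales (rule subalgebra_dirac)
  then interpret sigma_finite_subalgebra "dirac w" "dirac w"
    by (rule finite_measure_subalgebra_is_sigma_finite)
  have "AE v in dirac w. real_cond_exp (dirac w) (dirac w) (\<lambda>_. 0) v = 0"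
    using real_cond_exp_F_meas[of "\<lambda>_. 0"] by simp
  then show ?thesis by (simp add: is_martingale_def)
qed

text \<open>The deterministic times \<open>n\<close> serve as localising sequence.\<close>

lemma continuous_local_martingale_zero_dirac:
  "continuous_local_martingale (dirac w) (\<lambda>_. dirac w) (\<lambda>_ _. 0)"
proof -
  have "(\<lambda>n. ereal (real n)) \<longlonglongrightarrow> \<infinity>"
    by (rule Lim_PInfty[THEN iffD2]) (meson ereal_less_eq(3) of_nat_le_iff order_trans real_arch_simple)
  then show ?thesis
    unfolding continuous_local_martingale_def
    by (auto intro!: exI[of _ "\<lambda>n _. ereal (real n)"] continuous_adapted_dirac ext_stopping_time_dirac
        is_martingale_zero_dirac simp: AE_dirac incseq_def)
qed

text \<open>The path is its own finite-variation part, with martingale part 0; the Lipschitz bound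
  on [0,t] gives variation at most \<open>B * t\<close>.\<close>

lemma real_continuous_semimartingale_dirac:
  assumes L: "\<And>T. T \<ge> 0 \<Longrightarrow> \<exists>B. B-lipschitz_on {0..T} (\<lambda>t. Z t w)"
  shows "real_continuous_semimartingale (dirac w) (\<lambda>_. dirac w) Z"
proof -
  have "continuous_on {0..} (\<lambda>t. Z t w)"
    unfolding continuous_on_eq_continuous_within
  proof
    fix t :: real assume t: "t \<in> {0..}"
    then obtain B where "B-lipschitz_on {0..t + 1} (\<lambda>t. Z t w)" using L[of "t + 1"] by auto
    then have "continuous (at t within {0..t + 1}) (\<lambda>t. Z t w)"
      using t by (intro lipschitz_on_continuous_within) auto
    \<comment> \<open>Relative to the half-line, \<open>t\<close> is interior to [0,t+1], so the
      Lipschitz bound there gives continuity on the half-line.\<close>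
    moreover have "at t within {0..t + 1} = at t within {0..}"
      using t by (intro at_within_nhd[of _ "{..<t + 1}"]) auto
    ultimately show "continuous (at t within {0..}) (\<lambda>t. Z t w)" by simp
  qed
  then have ad: "continuous_adapted (dirac w) (\<lambda>_. dirac w) Z" by (rule continuous_adapted_dirac)
  have "\<exists>B. \<forall>n r. partition_of t n r \<longrightarrow> (\<Sum>k<n. \<bar>Z (r (Suc k)) w - Z (r k) w\<bar>) \<le> B"
    if t: "t \<ge> 0" for t
  proof -
    obtain B where B: "B-lipschitz_on {0..t} (\<lambda>t. Z t w)" using L[OF t] by auto
    have "(\<Sum>k<n. \<bar>Z (r (Suc k)) w - Z (r k) w\<bar>) \<le> B * t" if r: "partition_of t n r" for n r
    proof -
      have mono: "r j \<le> r k" if "j \<le> k" "k \<le> n" for j k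
        using that(1,2)
      proof (induction rule: dec_induct)
        case (step i)
        then show ?case using r unfolding partition_of_def by (metis Suc_le_lessD order_trans less_imp_le)
      qed simp
      have range: "r k \<in> {0..t}" if "k \<le> n" for k
        using mono[of 0 k] mono[of k n] that r by (auto simp: partition_of_def)
      have "(\<Sum>k<n. \<bar>Z (r (Suc k)) w - Z (r k) w\<bar>) \<le> (\<Sum>k<n. B * (r (Suc k) - r k))"
      proof (rule sum_mono)
        fix k assume "k \<in> {..<n}"
        then show "\<bar>Z (r (Suc k)) w - Z (r k) w\<bar> \<le> B * (r (Suc k) - r k)"
          using lipschitz_onD[OF B range[of "Suc k"] range[of k]] mono[of k "Suc k"]
          by (simp add: dist_real_def)
      qed
      also have "\<dots> = B * t"
        using r by (simp add: partition_of_def sum_lessThan_telescope flip: sum_distrib_left)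
      finally show ?thesis .
    qed
    then show ?thesis by blast
  qed
  then have "continuous_finite_variation (dirac w) (\<lambda>_. dirac w) Z"
    by (simp add: continuous_finite_variation_def ad AE_dirac)
  then show ?thesis
    unfolding real_continuous_semimartingale_def
    using ad continuous_local_martingale_zero_dirac[of w]
    by (intro conjI exI[of _ "\<lambda>_ _. 0"] exI[of _ Z]) (auto simp: AE_dirac)
qed

text \<open>The started and stopped coordinate process follows \<phi> along \<open>c\<close> at a
  clamped time, and clamping is 1-Lipschitz. A Lipschitz bound for the time spent in the chart
  therefore carries over to all of [0,T].\<close>

lemma continuous_semimartingale_dirac:
  assumes c: "continuous_on {0..} c" and L: "\<And>T. T \<ge> 0 \<Longrightarrow> chart_lipschitz A c 0 T"
  shows "continuous_semimartingale A (dirac w) (\<lambda>_. dirac w) (\<lambda>t _. c t)"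
  unfolding continuous_semimartingale_def
proof (intro conjI ballI, goal_cases)
  case 1
  show ?case using c by (intro continuous_adapted_dirac)
next
  case (2 K)
  obtain U \<phi> where K: "K = (U, \<phi>)" "(U, \<phi>) \<in> A" using 2 by (cases K) auto
  have "real_continuous_semimartingale (dirac w) (\<lambda>_. dirac w) (\<lambda>t \<omega>.
          if \<sigma> \<omega> \<le> ereal t
          then (\<phi> (c (clamp_time (\<sigma> \<omega>) (\<tau> \<omega>) t)) - \<phi> (c (real_of_ereal (\<sigma> \<omega>)))) \<bullet> b
          else 0)"
    if I: "chart_interval (dirac w) (\<lambda>_. dirac w) (\<lambda>t _. c t) U \<sigma> \<tau>" and b: "b \<in> Basis" for \<sigma> \<tau> b
  proof (rule real_continuous_semimartingale_dirac)
    fix T :: real assume T: "T \<ge> 0"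
    have \<sigma>\<tau>: "0 \<le> \<sigma> w" "\<sigma> w \<le> \<tau> w" "\<And>t. 0 \<le> t \<Longrightarrow> \<sigma> w \<le> ereal t \<Longrightarrow> ereal t \<le> \<tau> w \<Longrightarrow> c t \<in> U"
      using I by (auto simp: chart_interval_def ext_stopping_time_def)
    let ?Z = "\<lambda>t. if \<sigma> w \<le> ereal t
      then (\<phi> (c (clamp_time (\<sigma> w) (\<tau> w) t)) - \<phi> (c (real_of_ereal (\<sigma> w)))) \<bullet> b else 0"
    show "\<exists>B. B-lipschitz_on {0..T} ?Z"
    proof (cases "\<sigma> w \<le> ereal T")
      case False
      then have "?Z t = 0" if "t \<in> {0..T}" for t
        using that order_trans[of "\<sigma> w" "ereal t" "ereal T"] by auto
      then have "0-lipschitz_on {0..T} ?Z"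
        by (intro lipschitz_on_transform[OF lipschitz_on_constant[of _ 0]])
      then show ?thesis ..
    next
      case True
      then obtain s where s: "\<sigma> w = ereal s" "0 \<le> s" "s \<le> T"
        using \<sigma>\<tau>(1) by (cases "\<sigma> w") auto
      \<comment> \<open>Truncating at \<open>T\<close> gives a finite end of the chart interval even
        when \<open>\<tau> w\<close> is infinite.\<close>
      have "\<exists>e. min (\<tau> w) (ereal T) = ereal e \<and> s \<le> e \<and> e \<le> T"
        using \<sigma>\<tau>(2) s by (cases "\<tau> w") (auto simp: min_def)
      then obtain e where e: "min (\<tau> w) (ereal T) = ereal e" "s \<le> e" "e \<le> T"
        by blast
      have clamp: "clamp_time (\<sigma> w) (\<tau> w) t = max s (min e t)" if "t \<le> T" for t
        using s e that by (cases "\<tau> w") (auto simp: clamp_time_def min_def max_def split: if_splits)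
      have "c ` {s..e} \<subseteq> U"
        using \<sigma>\<tau>(3) s e by (cases "\<tau> w") (auto simp: min_def split: if_splits)
      then obtain B where B: "B-lipschitz_on {s..e} (\<phi> \<circ> c)"
        using chart_lipschitzD[OF L[OF T] K(2)] s e by blast
      have "(B * 1)-lipschitz_on {0..T} (\<lambda>t. (\<phi> \<circ> c) (max s (min e t)))"
      proof (rule lipschitz_on_compose2[where f = "\<lambda>t. max s (min e t)" and g = "\<phi> \<circ> c"])
        show "1-lipschitz_on {0..T} (\<lambda>t. max s (min e t))"
          by (auto simp: lipschitz_on_def dist_real_def max_def min_def)
        show "B-lipschitz_on ((\<lambda>t. max s (min e t)) ` {0..T}) (\<phi> \<circ> c)"
          using e(2) by (intro lipschitz_on_subset[OF B]) auto
      qed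
      note B = lipschitz_onD[OF this] lipschitz_on_nonneg[OF this]
      \<comment> \<open>Before \<open>s\<close> the clamped time is \<open>s\<close>, so the formula
        gives 0, which is the default value there.\<close>
      have Z: "?Z t = (\<phi> (c (max s (min e t))) - \<phi> (c s)) \<bullet> b" if "t \<in> {0..T}" for t
        using that e by (auto simp: s(1) clamp[unfolded s(1)] max_def min_def)
      have "(B * 1)-lipschitz_on {0..T} ?Z"
      proof (rule lipschitz_onI)
        fix x y assume xy: "x \<in> {0..T}" "y \<in> {0..T}"
        let ?h = "\<lambda>t. \<phi> (c (max s (min e t)))"
        have "dist (?Z x) (?Z y) = \<bar>(?h x - ?h y) \<bullet> b\<bar>"
          unfolding Z[OF xy(1)] Z[OF xy(2)] by (simp add: dist_real_def inner_diff_left)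
        also have "\<dots> \<le> dist (?h x) (?h y)"
          using Basis_le_norm[OF b] by (simp add: dist_norm)
        also have "\<dots> \<le> B * 1 * dist x y" using B(1)[OF xy] by simp
        finally show "dist (?Z x) (?Z y) \<le> B * 1 * dist x y" .
      qed (use B(2) in simp)
      then show ?thesis ..
    qed
  qed
  then show ?case unfolding K(1) prod.case by blast
qed


section \<open>Stratonovich integrals along deterministic paths\<close>

lemma
  assumes "smooth_atlas A"
  shows smooth_atlas_open: "\<forall>(U, \<phi>)\<in>A. open U"
    and smooth_atlas_inj: "(U, \<phi>) \<in> A \<Longrightarrow> inj_on \<phi> U"
    and smooth_atlas_cover: "\<exists>U \<phi>. (U, \<phi>) \<in> A \<and> x \<in> U"
proof -
  note a = assms[unfolded smooth_atlas_def]
  show "\<forall>(U, \<phi>)\<in>A. open U" using a by fast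
  show "inj_on \<phi> U" if "(U, \<phi>) \<in> A"
  proof -
    have "homeomorphism U (\<phi> ` U) \<phi> (inv_into U \<phi>)" using a that by fast
    then show ?thesis by (metis homeomorphism_apply1 inj_on_inverseI)
  qed
  have "x \<in> (\<Union>(U, \<phi>)\<in>A. U)" using a by simp
  then show "\<exists>U \<phi>. (U, \<phi>) \<in> A \<and> x \<in> U" by auto
qed

text \<open>The zero coordinate vector is the zero derivation, which a form kills by linearity.
  Hence steps between equal points contribute nothing to a trapezoidal sum.\<close>

lemma form_coeff_zero:
  assumes "inj_on \<phi> U" "(U, \<phi>) \<in> A" "x \<in> U" "smooth_one_form A \<theta>"
  shows "form_coeff A (U, \<phi>) \<theta> (\<phi> x) 0 = 0"
proof -
  have "coord_vec A (U, \<phi>) x 0 f = 0" for f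
  proof (cases "smooth_fun A f")
    case True
    then have "smooth_on (\<phi> ` U) (f \<circ> inv_into U \<phi>)"
      using assms(2) unfolding smooth_fun_def by fast
    then have "Ck_on (Suc 0) (\<phi> ` U) (f \<circ> inv_into U \<phi>)"
      unfolding smooth_on_def by blast
    then have "(f \<circ> inv_into U \<phi>) differentiable (at (\<phi> x))"
      using assms(3) by simp
    then have "linear (frechet_derivative (f \<circ> inv_into U \<phi>) (at (\<phi> x)))"
      using frechet_derivative_works has_derivative_linear by blast
    from linear_0[OF this] show ?thesis by (simp add: coord_vec_def)
  qed (simp add: coord_vec_def)
  then have "coord_vec A (U, \<phi>) x 0 = (\<lambda>_. 0)" by blast
  moreover have "\<theta> x (\<lambda>_. 0) = 0"
  proof -
    define Z :: "'a tvec" where "Z = (\<lambda>_. 0)"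
    have "Z \<in> tangent_space A x" by (simp add: tangent_space_def Z_def)
    then have "\<theta> x (\<lambda>f. 0 * Z f + 0 * Z f) = 0 * \<theta> x Z + 0 * \<theta> x Z"
      using assms(4) unfolding smooth_one_form_def by blast
    then show ?thesis by (simp add: Z_def)
  qed
  ultimately show ?thesis
    using assms(1,3) by (simp add: form_coeff_def)
qed

section \<open>Trapezoidal sums and integrals along fixed paths\<close>

lemma partition_of_mesh_exists:
  assumes "t \<ge> 0" "\<delta> > 0"
  obtains n r where "partition_of t n r" "\<And>k. r (Suc k) - r k < \<delta>"
proof -
  obtain n where n: "t / \<delta> < real n" using reals_Archimedean2 by blast
  then have "n > 0" using assms by (cases "n = 0") (auto simp: field_simps)
  define r where "r = (\<lambda>k. t * real k / real n)"
  have step: "r (Suc k) - r k = t / real n" for k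
    using \<open>n > 0\<close> by (simp add: r_def field_simps)
  have "partition_of t n r"
    using \<open>n > 0\<close> assms by (simp add: partition_of_def r_def divide_right_mono mult_left_mono)
  moreover have "t / real n < \<delta>" using n \<open>n > 0\<close> assms by (simp add: field_simps)
  ultimately show ?thesis using that step by simp
qed

text \<open>Under a point mass every event has probability 0 or 1, so a probability below 1 for a
  large error rules it out at \<open>w\<close>: limits in probability become plain limits.\<close>

lemma stratonovich_increment_dirac:
  assumes I: "is_stratonovich A (dirac w) (\<lambda>_. dirac w) (\<lambda>t _. c t) \<theta> I"
    and K: "(U, \<phi>) \<in> A" and ab: "0 \<le> a" "a \<le> b" and c: "c ` {a..b} \<subseteq> U" and "\<epsilon> > 0"
  obtains \<delta> where "\<delta> > 0" "\<And>n r. partition_of b n r \<Longrightarrow> (\<And>k. r (Suc k) - r k < \<delta>) \<Longrightarrow>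
    \<bar>stratonovich_sum A (U, \<phi>) \<theta> c n (\<lambda>k. max a (min b (r k))) - (I b w - I a w)\<bar> \<le> \<epsilon>"
proof -
  \<comment> \<open>This number is both the error threshold and the probability bound; the cap 1/2
    keeps it below 1.\<close>
  define e where "e = min \<epsilon> (1/2)"
  have e: "e > 0" "e \<le> \<epsilon>" "e < 1" using \<open>\<epsilon> > 0\<close> by (auto simp: e_def)
  have clamp: "clamp_time (ereal a) (ereal b) r = max a (min b r)" for r
    by (simp add: clamp_time_def min_def max_def)
  have "chart_interval (dirac w) (\<lambda>_. dirac w) (\<lambda>t _. c t) U (\<lambda>_. ereal a) (\<lambda>_. ereal b)"
    using ab c by (auto simp: chart_interval_def ext_stopping_time_dirac)
  then have "\<forall>t\<ge>0. \<forall>\<epsilon>>0. \<exists>\<delta>>0. \<forall>n r. partition_of t n r \<and> (\<forall>k<n. r (Suc k) - r k < \<delta>) \<longrightarrow>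
          measure (dirac w) {\<omega>\<in>space (dirac w). ereal a \<le> ereal t \<and>
            \<bar>stratonovich_sum A (U, \<phi>) \<theta> c n (\<lambda>k. clamp_time (ereal a) (ereal b) (r k))
             - (I (clamp_time (ereal a) (ereal b) t) \<omega> - I (real_of_ereal (ereal a)) \<omega>)\<bar> > \<epsilon>} < \<epsilon>"
    using I K unfolding is_stratonovich_def by fast
  from this[rule_format, of b e] obtain \<delta> where \<delta>: "\<delta> > 0"
    "\<And>n r. partition_of b n r \<and> (\<forall>k<n. r (Suc k) - r k < \<delta>) \<Longrightarrow>
          measure (dirac w) {\<omega>\<in>{w}. \<bar>stratonovich_sum A (U, \<phi>) \<theta> c n (\<lambda>k. max a (min b (r k)))
             - (I b \<omega> - I a \<omega>)\<bar> > e} < e"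
    using ab e(1) by (auto simp: clamp)
  have "\<bar>stratonovich_sum A (U, \<phi>) \<theta> c n (\<lambda>k. max a (min b (r k))) - (I b w - I a w)\<bar> \<le> \<epsilon>"
    if "partition_of b n r" "\<And>k. r (Suc k) - r k < \<delta>" for n r
  proof -
    let ?S = "{\<omega>\<in>{w}. \<bar>stratonovich_sum A (U, \<phi>) \<theta> c n (\<lambda>k. max a (min b (r k)))
             - (I b \<omega> - I a \<omega>)\<bar> > e}"
    have "indicator ?S w < e"
      unfolding measure_dirac[of ?S w, OF Collect_restrict, symmetric] using that by (intro \<delta>(2)) simp
    then have "w \<notin> ?S" using e(3) by (auto simp: indicator_def)
    then show ?thesis using e(2) by simp
  qed
  with \<delta>(1) show ?thesis by (rule that)
qed

lemma stratonovich_sum_cong: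
  assumes "\<And>k. k \<le> n \<Longrightarrow> c (u k) = c' (u k)"
  shows "stratonovich_sum A K \<theta> c n u = stratonovich_sum A K \<theta> c' n u"
  unfolding stratonovich_sum_def using assms by (intro sum.cong) auto

text \<open>Both increments are limits of the same trapezoidal sums, as the clamped partition points
  stay in [a,b], where the paths agree.\<close>

lemma stratonovich_chart_increment_eq:
  assumes I: "is_stratonovich A (dirac w) (\<lambda>_. dirac w) (\<lambda>t _. c t) \<theta> I"
    and I': "is_stratonovich A (dirac w) (\<lambda>_. dirac w) (\<lambda>t _. c' t) \<theta> I'"
    and K: "(U, \<phi>) \<in> A" and ab: "0 \<le> a" "a \<le> b" and c: "c ` {a..b} \<subseteq> U"
    and eq: "\<And>t. a \<le> t \<Longrightarrow> t \<le> b \<Longrightarrow> c' t = c t"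
  shows "I b w - I a w = I' b w - I' a w"
proof -
  have c': "c' ` {a..b} \<subseteq> U" using c eq by auto
  have "\<bar>(I b w - I a w) - (I' b w - I' a w)\<bar> \<le> 0 + e" if "e > 0" for e
  proof -
    have e2: "e / 2 > 0" using that by simp
    obtain d where d: "d > 0" "\<And>n r. partition_of b n r \<Longrightarrow> (\<And>k. r (Suc k) - r k < d) \<Longrightarrow>
      \<bar>stratonovich_sum A (U, \<phi>) \<theta> c n (\<lambda>k. max a (min b (r k))) - (I b w - I a w)\<bar> \<le> e / 2"
      using stratonovich_increment_dirac[OF I K ab c e2] by blast
    obtain d' where d': "d' > 0" "\<And>n r. partition_of b n r \<Longrightarrow> (\<And>k. r (Suc k) - r k < d') \<Longrightarrow>
      \<bar>stratonovich_sum A (U, \<phi>) \<theta> c' n (\<lambda>k. max a (min b (r k))) - (I' b w - I' a w)\<bar> \<le> e / 2"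
      using stratonovich_increment_dirac[OF I' K ab c' e2] by blast
    \<comment> \<open>One partition is taken fine enough for both integrals.\<close>
    obtain n r where r: "partition_of b n r" "\<And>k. r (Suc k) - r k < min d d'"
      using partition_of_mesh_exists[of b "min d d'"] ab d(1) d'(1) by auto
    have "stratonovich_sum A (U, \<phi>) \<theta> c' n (\<lambda>k. max a (min b (r k))) =
        stratonovich_sum A (U, \<phi>) \<theta> c n (\<lambda>k. max a (min b (r k)))"
      by (rule stratonovich_sum_cong) (use ab in \<open>auto intro!: eq\<close>)
    moreover have "r (Suc k) - r k < d" "r (Suc k) - r k < d'" for k
      using r(2)[of k] by auto
    ultimately have "\<bar>stratonovich_sum A (U, \<phi>) \<theta> c n (\<lambda>k. max a (min b (r k))) - (I b w - I a w)\<bar> \<le> e / 2"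
        "\<bar>stratonovich_sum A (U, \<phi>) \<theta> c n (\<lambda>k. max a (min b (r k))) - (I' b w - I' a w)\<bar> \<le> e / 2"
      using d(2)[OF r(1)] d'(2)[OF r(1)] by auto
    then show ?thesis by arith
  qed
  then have "\<bar>(I b w - I a w) - (I' b w - I' a w)\<bar> \<le> 0" by (rule field_le_epsilon)
  then show ?thesis by simp
qed

text \<open>The difference of the two integrals is locally constant, because near each time the path
  stays in one chart, where increments agree. Connectedness of [p,q] makes it constant.\<close>

lemma stratonovich_increment_eq:
  assumes A: "smooth_atlas A"
    and I: "is_stratonovich A (dirac w) (\<lambda>_. dirac w) (\<lambda>t _. c t) \<theta> I"
    and I': "is_stratonovich A (dirac w) (\<lambda>_. dirac w) (\<lambda>t _. c' t) \<theta> I'"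
    and pq: "0 \<le> p" "p \<le> q" and cont: "continuous_on {p..q} c"
    and eq: "\<And>t. p \<le> t \<Longrightarrow> t \<le> q \<Longrightarrow> c' t = c t"
  shows "I q w - I p w = I' q w - I' p w"
proof -
  have "I p w - I' p w = I q w - I' q w"
  proof (rule connected_local_const[where A = "{p..q}" and f = "\<lambda>t. I t w - I' t w"])
    show "\<forall>t\<in>{p..q}. eventually (\<lambda>u. I t w - I' t w = I u w - I' u w) (at t within {p..q})"
    proof
      fix t assume t: "t \<in> {p..q}"
      obtain U \<phi> where K: "(U, \<phi>) \<in> A" "c t \<in> U" using smooth_atlas_cover[OF A] by metis
      have "open U" using smooth_atlas_open[OF A] K(1) by fast
      have "(c \<longlongrightarrow> c t) (at t within {p..q})"
        using cont t by (simp add: continuous_on_def)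
      then have "eventually (\<lambda>u. c u \<in> U) (at t within {p..q})"
        using \<open>open U\<close> K(2) by (rule topological_tendstoD)
      then obtain d where d: "d > 0" "\<And>u. u \<in> {p..q} \<Longrightarrow> u \<noteq> t \<Longrightarrow> dist u t < d \<Longrightarrow> c u \<in> U"
        unfolding eventually_at by auto
      have "I t w - I' t w = I u w - I' u w" if u: "u \<in> {p..q}" "dist u t < d" for u
      proof -
        \<comment> \<open>All times between \<open>t\<close> and \<open>u\<close> are within
          \<open>d\<close> of \<open>t\<close>, so one chart covers this stretch; \<open>min\<close>
          and \<open>max\<close> treat both orders at once.\<close>
        have "c v \<in> U" if "v \<in> {min t u..max t u}" for v
        proof (cases "v = t")
          case False
          then show ?thesis
            using that t u by (intro d(2)) (auto simp: dist_real_def min_def max_def split: if_splits)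
        qed (simp add: K(2))
        then have "I (max t u) w - I (min t u) w = I' (max t u) w - I' (min t u) w"
          using t u pq by (intro stratonovich_chart_increment_eq[OF I I' K(1)]) (auto intro!: eq)
        then show ?thesis by (auto simp: min_def max_def split: if_splits)
      qed
      then show "eventually (\<lambda>u. I t w - I' t w = I u w - I' u w) (at t within {p..q})"
        unfolding eventually_at using d(1) by blast
    qed
  qed (use pq in auto)
  then show ?thesis by simp
qed

text \<open>A path at rest stays in one chart and its trapezoidal sums vanish, so the integral keeps
  its initial value 0.\<close>

lemma stratonovich_constant:
  assumes A: "smooth_atlas A" and \<theta>: "smooth_one_form A \<theta>"
    and I: "is_stratonovich A (dirac w) (\<lambda>_. dirac w) (\<lambda>t _. c t) \<theta> I"
    and "0 \<le> q" and const: "\<And>t. 0 \<le> t \<Longrightarrow> t \<le> q \<Longrightarrow> c t = x"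
  shows "I q w = 0"
proof -
  obtain U \<phi> where K: "(U, \<phi>) \<in> A" "x \<in> U" using smooth_atlas_cover[OF A] by metis
  have c: "c ` {0..q} \<subseteq> U" using const K(2) by auto
  have "\<bar>I q w - I 0 w\<bar> \<le> 0 + e" if "e > 0" for e
  proof -
    obtain d where d: "d > 0" "\<And>n r. partition_of q n r \<Longrightarrow> (\<And>k. r (Suc k) - r k < d) \<Longrightarrow>
      \<bar>stratonovich_sum A (U, \<phi>) \<theta> c n (\<lambda>k. max 0 (min q (r k))) - (I q w - I 0 w)\<bar> \<le> e"
      using stratonovich_increment_dirac[OF I K(1) order_refl \<open>0 \<le> q\<close> c \<open>e > 0\<close>] by blast
    obtain n r where r: "partition_of q n r" "\<And>k. r (Suc k) - r k < d"
      using partition_of_mesh_exists[OF \<open>0 \<le> q\<close> d(1)] by blast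
    have "c (max 0 (min q (r k))) = x" for k
      using \<open>0 \<le> q\<close> by (intro const) auto
    then have "stratonovich_sum A (U, \<phi>) \<theta> c n (\<lambda>k. max 0 (min q (r k))) = 0"
      using form_coeff_zero[OF smooth_atlas_inj[OF A K(1)] K \<theta>]
      by (simp add: stratonovich_sum_def)
    then show ?thesis using d(2)[OF r] by simp
  qed
  then have "\<bar>I q w - I 0 w\<bar> \<le> 0" by (rule field_le_epsilon)
  moreover have "I 0 w = 0" using I by (simp add: is_stratonovich_def)
  ultimately show ?thesis by simp
qed


section \<open>Bounding the triangle class\<close>

text \<open>Each leg takes one unit of time; resting at the end afterwards extends the path to all
  times, as a process requires.\<close>

definition concat_path :: "(real \<Rightarrow> 'a) \<Rightarrow> (real \<Rightarrow> 'a) \<Rightarrow> real \<Rightarrow> 'a"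
  where "concat_path p q t = (if t \<le> 1 then p t else if t \<le> 2 then q (t - 1) else q 1)"

lemma continuous_on_concat_path:
  assumes "path p" "path q" "pathfinish p = pathstart q"
  shows "continuous_on {0..} (concat_path p q)"
proof -
  have p: "continuous_on {0..1} p" and q: "continuous_on {0..1} q" and pq: "p 1 = q 0"
    using assms by (auto simp: path_def pathfinish_def pathstart_def)
  have 1: "continuous_on ({0..1} \<union> {1..}) (\<lambda>t. if t \<le> 1 then p t else q (min 1 (t - 1)))"
    by (intro continuous_on_If continuous_on_compose2[OF q] p continuous_intros) (auto simp: pq)
  have "{0..1} \<union> {1..} = {0::real..}" by auto
  with 1 have "continuous_on {0..} (\<lambda>t. if t \<le> 1 then p t else q (min 1 (t - 1)))" by simp
  then show ?thesis
    by (rule continuous_on_eq) (auto simp: concat_path_def min_def)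
qed

lemma chart_lipschitz_concat_path:
  assumes p: "chart_lipschitz A p 0 1" and q: "chart_lipschitz A q 0 1"
    and pq: "pathfinish p = pathstart q"
  shows "chart_lipschitz A (concat_path p q) 0 T"
proof -
  have "chart_lipschitz A (concat_path p q) 0 1"
    by (rule chart_lipschitz_cong[OF p]) (simp add: concat_path_def)
  moreover have "chart_lipschitz A (\<lambda>t. q (t - 1)) 1 2"
    using chart_lipschitz_shift[OF q, of 1] by simp
  then have "chart_lipschitz A (concat_path p q) 1 2"
    by (rule chart_lipschitz_cong)
      (use pq in \<open>auto simp: concat_path_def pathfinish_def pathstart_def\<close>)
  \<comment> \<open>The path rests here; for \<open>T < 2\<close> the claim is vacuous.\<close>
  moreover have "chart_lipschitz A (concat_path p q) 2 T"
    by (rule chart_lipschitz_cong[OF chart_lipschitz_const[of A "q 1"]]) (simp add: concat_path_def)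
  ultimately show ?thesis using chart_lipschitz_join by blast
qed

lemma norm_on_space_triangle3:
  assumes "norm_on_space N"
  shows "N (a - b - c) \<le> N a + N b + N c"
proof -
  have add: "N (x + y) \<le> N x + N y" and neg: "N (- x) = N x" for x y
    using assms unfolding norm_on_space_def
    by (blast, metis abs_minus_cancel abs_one mult_1 scaleR_minus1_left)
  have "N (a - b - c) \<le> N (a + - b) + N (- c)" using add[of "a + - b" "- c"] by simp
  also have "\<dots> \<le> N a + N (- b) + N (- c)" using add[of a "- b"] by simp
  finally show ?thesis by (simp add: neg)
qed

text \<open>On the path through \<open>x\<close>, \<open>y\<close>, \<open>z\<close> the triangle
  class is the defect for two unit times. The path resting at \<open>y\<close> realises the shifted
  path without moving the time parameter, so the integrals over [1,2] can be compared
  directly.\<close>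

lemma triangle_class_bound:
  fixes A :: "('m::{second_countable_topology,t2_space}, 'e::euclidean_space) chart set"
    and w :: 'w
  assumes A: "smooth_atlas A" and \<gamma>: "closing_family \<gamma>" "\<And>x y. piecewise_smooth_path A (\<gamma> x y)"
    and N: "norm_on_space N" and \<xi>: "linear_closed_representatives A \<xi>"
    and C: "\<And>(P' :: 'w measure) F' X'. filtered_prob_space P' F' \<Longrightarrow> continuous_semimartingale A P' F' X' \<Longrightarrow>
           \<exists>J. is_homology_integral A P' F' X' \<xi> J \<and>
             (AE \<omega> in P'. \<forall>t\<ge>0. N (homology_process \<gamma> t (\<lambda>u. X' u \<omega>) - J t \<omega>) \<le> C)"
  shows "N (triangle_class \<gamma> x y z) \<le> 3 * C"
proof -
  note g = \<gamma>(1)[unfolded closing_family_def, rule_format]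
  \<comment> \<open>This is the hypothesis at the point mass, where an almost sure bound holds at
    \<open>w\<close>; one \<open>J\<close> serves all \<alpha> and all \<open>t\<close>.\<close>
  have sm: "\<exists>J. (\<forall>\<alpha>. is_stratonovich A (dirac w) (\<lambda>_. dirac w) (\<lambda>t _. concat_path p q t) (\<xi> \<alpha>)
        (\<lambda>t \<omega>. cpair \<alpha> (J t \<omega>))) \<and> (\<forall>t\<ge>0. N (homology_process \<gamma> t (concat_path p q) - J t w) \<le> C)"
    if "path p" "path q" "pathfinish p = pathstart q" "chart_lipschitz A p 0 1" "chart_lipschitz A q 0 1"
    for p q
    using C[OF filtered_prob_space_dirac continuous_semimartingale_dirac[OF
        continuous_on_concat_path[OF that(1-3)] chart_lipschitz_concat_path[OF that(4,5,3)]], of w]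
    unfolding is_homology_integral_def AE_dirac by blast
  have L: "chart_lipschitz A (\<gamma> u v) 0 1" for u v
    by (rule chart_lipschitz_piecewise_smooth[OF smooth_atlas_open[OF A] \<gamma>(2)])
  define X where "X = concat_path (\<gamma> x y) (\<gamma> y z)"
  define Y where "Y = concat_path (\<lambda>_. y) (\<gamma> y z)"
  have const: "path (\<lambda>_::real. y)" "pathfinish (\<lambda>_. y) = y"
    by (simp_all add: path_def pathfinish_def)
  have X: "continuous_on {0..} X" unfolding X_def
    by (rule continuous_on_concat_path) (simp_all add: g)
  have Y: "continuous_on {0..} Y" unfolding Y_def
    by (rule continuous_on_concat_path) (simp_all add: g const)
  obtain J where J: "\<And>\<alpha>. is_stratonovich A (dirac w) (\<lambda>_. dirac w) (\<lambda>t _. X t) (\<xi> \<alpha>)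
        (\<lambda>t \<omega>. cpair \<alpha> (J t \<omega>))" "\<And>t. t \<ge> 0 \<Longrightarrow> N (homology_process \<gamma> t X - J t w) \<le> C"
    using sm[of "\<gamma> x y" "\<gamma> y z"] g L unfolding X_def by metis
  obtain J' where J': "\<And>\<alpha>. is_stratonovich A (dirac w) (\<lambda>_. dirac w) (\<lambda>t _. Y t) (\<xi> \<alpha>)
        (\<lambda>t \<omega>. cpair \<alpha> (J' t \<omega>))" "\<And>t. t \<ge> 0 \<Longrightarrow> N (homology_process \<gamma> t Y - J' t w) \<le> C"
    using sm[of "\<lambda>_. y" "\<gamma> y z"] g L const chart_lipschitz_const unfolding Y_def by metis
  have ends: "\<gamma> u v 0 = u" "\<gamma> u v 1 = v" for u v
    using g[of u v] by (auto simp: pathstart_def pathfinish_def)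
  have vals: "X 0 = x" "X 1 = y" "X 2 = z" and XY: "\<And>t. t \<ge> 1 \<Longrightarrow> Y t = X t"
    and Yc: "\<And>t. 0 \<le> t \<Longrightarrow> t \<le> 1 \<Longrightarrow> Y t = y"
    by (auto simp: X_def Y_def concat_path_def ends)
  \<comment> \<open>Tested against \<alpha>, both integrals have the same increment over [1,2], and
    that of \<open>Y\<close> starts from 0 since \<open>Y\<close> rests up to time 1.\<close>
  have "J 2 w - J 1 w - J' 2 w = 0"
  proof (rule cpair_nondegenerate)
    fix \<alpha>
    have "smooth_one_form A (\<xi> \<alpha>)"
      using \<xi> unfolding linear_closed_representatives_def closed_one_form_def by blast
    then have "cpair \<alpha> (J' 1 w) = 0"
      using stratonovich_constant[OF A _ J'(1) _ Yc] by simp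
    moreover have "cpair \<alpha> (J 2 w) - cpair \<alpha> (J 1 w) = cpair \<alpha> (J' 2 w) - cpair \<alpha> (J' 1 w)"
      by (rule stratonovich_increment_eq[OF A J(1) J'(1)])
        (auto intro!: continuous_on_subset[OF X] XY)
    ultimately show "cpair \<alpha> (J 2 w - J 1 w - J' 2 w) = 0" by (simp add: cpair_diff)
  qed
  moreover have "triangle_class \<gamma> x y z =
      homology_process \<gamma> 2 X - homology_process \<gamma> 1 X - homology_process \<gamma> 1 (time_shift 1 X)"
    using homology_process_defect[OF \<gamma>(1) X, of 1 1] by (simp add: vals)
  moreover have "homology_process \<gamma> 1 (time_shift 1 X) = homology_process \<gamma> 1 (time_shift 1 Y)"
    by (rule homology_process_cong) (simp_all add: time_shift_def XY)
  moreover have "homology_process \<gamma> 2 Y = homology_process \<gamma> 1 (time_shift 1 Y)"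
    using homology_process_constant_start[OF \<gamma>(1) Y, of 1 1] by (simp add: Yc)
  \<comment> \<open>Subtracting the vanishing combination of \<open>J\<close> and \<open>J'\<close>
    pairs each homology term with its own integral.\<close>
  ultimately have "triangle_class \<gamma> x y z = (homology_process \<gamma> 2 X - J 2 w)
      - (homology_process \<gamma> 1 X - J 1 w) - (homology_process \<gamma> 2 Y - J' 2 w)"
    by (simp add: algebra_simps)
  then have "N (triangle_class \<gamma> x y z) \<le> N (homology_process \<gamma> 2 X - J 2 w)
      + N (homology_process \<gamma> 1 X - J 1 w) + N (homology_process \<gamma> 2 Y - J' 2 w)"
    using norm_on_space_triangle3[OF N] by simp
  then show ?thesis using J(2)[of 2] J(2)[of 1] J'(2)[of 2] by simp
qed

theorem corollary5p2:
  fixes A :: "('m::{second_countable_topology,t2_space}, 'e::euclidean_space) chart set"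
    and g :: "'m \<Rightarrow> 'm tvec \<Rightarrow> 'm tvec \<Rightarrow> real"
    and \<gamma> :: "'m \<Rightarrow> 'm \<Rightarrow> real \<Rightarrow> 'm"
    and N :: "'m hom1 \<Rightarrow> real"
    and \<xi> :: "'m cohom1 \<Rightarrow> 'm \<Rightarrow> 'm tvec \<Rightarrow> real"
    and C :: real
    and P :: "'w measure" and F :: "real \<Rightarrow> 'w measure" and X :: "real \<Rightarrow> 'w \<Rightarrow> 'm"
  assumes "compact (UNIV :: 'm set)" and "connected (UNIV :: 'm set)"
    and "smooth_atlas A" and "riemannian_metric A g"
    and "bounded_borel_closing_family A g \<gamma>"
    and "norm_on_space N"
    and "linear_closed_representatives A \<xi>"
    and "\<And>(P' :: 'w measure) F' X'. filtered_prob_space P' F' \<Longrightarrow> continuous_semimartingale A P' F' X' \<Longrightarrow>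
           \<exists>J. is_homology_integral A P' F' X' \<xi> J \<and>
             (AE \<omega> in P'. \<forall>t\<ge>0. N (homology_process \<gamma> t (\<lambda>u. X' u \<omega>) - J t \<omega>) \<le> C)"
    and "filtered_prob_space P F" and "continuous_semimartingale A P F X"
  shows "\<forall>\<omega>\<in>space P. \<forall>s\<ge>0. \<forall>t\<ge>0.
    N (homology_process \<gamma> (s + t) (\<lambda>u. X u \<omega>) - homology_process \<gamma> s (\<lambda>u. X u \<omega>)
       - homology_process \<gamma> t (time_shift s (\<lambda>u. X u \<omega>))) \<le> 3 * C"
proof (intro ballI allI impI)
  fix \<omega> and s t :: real
  assume \<omega>: "\<omega> \<in> space P" and st: "0 \<le> s" "0 \<le> t"
  have pw: "piecewise_smooth_path A (\<gamma> x y)" "pathstart (\<gamma> x y) = x" "pathfinish (\<gamma> x y) = y" for x y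
    using assms(5) unfolding bounded_borel_closing_family_def by auto
  then have cf: "closing_family \<gamma>"
    by (simp add: closing_family_def piecewise_smooth_path_def)
  note bound = triangle_class_bound[OF assms(3) cf pw(1) assms(6-8)]
  have N0: "N 0 = 0" "\<And>h. 0 \<le> N h"
    using assms(6) by (auto simp: norm_on_space_def)
  have cont: "continuous_on {0..} (\<lambda>u. X u \<omega>)"
    using assms(10) \<omega> by (simp add: continuous_semimartingale_def continuous_adapted_def)
  \<comment> \<open>If one of the times is 0, the convention \<open>H\<^sub>0 = 0\<close> makes the
    defect vanish.\<close>
  consider "s = 0" | "t = 0" | "s > 0" "t > 0" using st by linarith
  then show "N (homology_process \<gamma> (s + t) (\<lambda>u. X u \<omega>) - homology_process \<gamma> s (\<lambda>u. X u \<omega>)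
       - homology_process \<gamma> t (time_shift s (\<lambda>u. X u \<omega>))) \<le> 3 * C"
  proof cases
    case 1
    have "time_shift 0 (\<lambda>u. X u \<omega>) = (\<lambda>u. X u \<omega>)" by (simp add: time_shift_def fun_eq_iff)
    then have "homology_process \<gamma> (s + t) (\<lambda>u. X u \<omega>) - homology_process \<gamma> s (\<lambda>u. X u \<omega>)
       - homology_process \<gamma> t (time_shift s (\<lambda>u. X u \<omega>)) = 0"
      using 1 by (simp add: homology_process_def)
    \<comment> \<open>Nonnegativity of \<open>3 * C\<close> is read off from the triangle bound, as
      norms are nonnegative.\<close>
    then show ?thesis using order_trans[OF N0(2) bound] N0(1) by simp
  next
    case 2
    then have "homology_process \<gamma> (s + t) (\<lambda>u. X u \<omega>) - homology_process \<gamma> s (\<lambda>u. X u \<omega>)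
       - homology_process \<gamma> t (time_shift s (\<lambda>u. X u \<omega>)) = 0"
      by (simp add: homology_process_def)
    then show ?thesis using order_trans[OF N0(2) bound] N0(1) by simp
  next
    case 3
    show ?thesis
      \<comment> \<open>The bound concerns three points of the path only, so it holds for every
        \<omega> and all times, with no exceptional set.\<close>
      unfolding homology_process_defect[OF cf cont 3] by (rule bound)
  qed
qed

end
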